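(* Let $R$ be a preparation map and put $\hat F_{xy}=\delta\hat\Pi_x^{R,1}-\hat\Pi_y^{R,1}d\Gamma_{yx}^R$. For every decorated tree $\tau\in\mathcal T_0$ and all space-time points $x,y$, $$\big(\hat F_{xy}\,\mathcal I_2(\tau)\big)(y)=\Big(\partial_{x_1}^2\big(\delta\hat\Pi_x^{R,1}-\hat\Pi_y^{R,1}d\Gamma_{yx}^R\big)(\mathcal I(\tau))\Big)(y),$$ where $\partial_{x_1}$ is the derivative in the spatial variable.
   Context: **Trees.** Let $d=1$. For $k=(k_0,k_1)\in\mathbb N^{2}$ put $|k|=2k_0+k_1$ and $k!=k_0!k_1!$. A decorated tree is a non-planar rooted tree with node decorations in $\mathbb N^{2}$ and edge decorations in $\{\mathcal I,\Xi_0,\Xi_1\}\times\mathbb N^{2}$. $T$ is the set of decorated trees, $\mathcal T$ its linear span. The tree product identifies the roots and adds their decorations; its unit $\mathbf 1$ is the single node decorated by $0$. $X^k$ is the single node decorated by $k$, $X_j=X^{e_j}$ ($j=0,1$); $\Xi_i$ is the tree with one edge, decorated by $(\Xi_i,0)$; $\mathcal I_a(\tau)$ grafts $\tau$ onto a new root (decorated $0$) via an edge decorated by $(\mathcal I,a)$ (a planted tree); $\mathcal I=\mathcal I_0$ and $\mathcal I_2=\mathcal I_{(0,2)}$. Trees have the form $X^k\Xi_0^l\Xi_1^m\prod_{i}\mathcal I_{a_i}(\tau_i)$ with $l+m\le1$. $|\tau|_\Xi$ is the number of noises $\Xi_0,\Xi_1$ in $\tau$. **Degrees.** Let $\alpha\in\mathbb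 R$ be the space-time regularity of the noise $\xi$. Put $\deg_0(\Xi_0)=\deg_1(\Xi_0)=\deg_1(\Xi_1)=\alpha$, $\deg_0(\Xi_1)=\alpha+\frac{d+2}2$, and for $i=0,1$: $\deg_i(X^k)=|k|$, $\deg_i$ is additive for the tree product, $\deg_i(\mathcal I_a(\tau))=\deg_i(\tau)+2-|a|$. **Spaces.** The setting is the quasilinear equation $\partial_tu-\partial_x^2u=f(u)\partial_x^2u+\xi$ on $\mathbb R_+\times\mathbb R$. $T_0\subset T$ is the set of trees (without $\Xi_1$) generated by the complete rule: the edges leaving any node away from the root form either $\prod_{i\in I}\mathcal I(\cdot)$, or $(\prod_{i\in I}\mathcal I(\cdot))\mathcal I_2(\cdot)$, or $\Xi_0$, with $I$ a finite set (polynomial node decorations are allowed). $\mathcal T_0$ is its span, which is stable under the preparation map $R$ and under the coactions below. $T_1$ is the set of trees obtained from trees in $T_0$ by replacing at most one $\Xi_0$ by $\Xi_1$; $\mathcal T_1$ is its span. $\mathcal T^{+,i}$ is the algebra spanned by $X^k\prod_j\mathcal I^{+,i}_{a_j}(\tau_j)$ with $\tau_j\in T$, $\deg_i(\mathcal I_{a_j}(\tau_j))>0$; $\mathcal I^{+,i}_a$ is a new symbol, extended linearly, with $\mathcal I^{+,i}_a(\tau)=0$ if $\deg_i(\mathcal I_a(\tau))\le0$. $\mathcal T^+=\mathcal T^{+,0}$, and $\mathcal M^+$ is the multiplication on $\mathcal T^+$. **Coactions.** $\Delta_i$ (with values in $\mathcal T\otimes\mathcal T^{+,i}$) is linear and multiplicative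 with $\Delta_i\mathbf 1=\mathbf 1\otimes\mathbf 1$, $\Delta_iX_j=X_j\otimes\mathbf 1+\mathbf 1\otimes X_j$, $\Delta_i\Xi_j=\Xi_j\otimes\mathbf 1$, $\Delta_i\mathcal I_a\tau=(\mathcal I_a\otimes\mathrm{Id})\Delta_i\tau+\sum_{|\ell+m|<\deg_i(\mathcal I_a\tau)}\frac{X^\ell}{\ell!}\otimes\frac{X^m}{m!}\mathcal I^{+,i}_{a+\ell+m}(\tau)$. The coproduct $\Delta_i^+:\mathcal T^{+,i}\to\mathcal T^{+,i}\otimes\mathcal T^{+,i}$ is multiplicative with $\Delta^+_iX_j=X_j\otimes\mathbf1+\mathbf1\otimes X_j$, $\Delta_i^+\mathcal I_a^{+,i}\tau=\sum_{|\ell|<\deg_i(\mathcal I_a\tau)}\big(\mathcal I^{+,i}_{a+\ell}\otimes\frac{(-X)^\ell}{\ell!}\big)\Delta_i\tau+\mathbf 1\otimes\mathcal I_a^{+,i}\tau$; it makes $\mathcal T^{+,i}$ a Hopf algebra with antipode $\mathcal A_i$. The map $\hat\Delta_0$ (with values in $\mathcal T\otimes\mathcal T^+$) is linear and multiplicative with $\hat\Delta_0(\bullet)=\bullet\otimes\mathbf 1$ for $\bullet\in\{\mathbf 1,X_j,\Xi_i\}$ and $\hat\Delta_0(\mathcal I_a\tau)=(\mathcal I_a\otimes\mathrm{Id})\hat\Delta_0\tau-\sum_{\deg_1(\mathcal I_a\tau)\le|\ell|}\frac{X^\ell}{\ell!}\otimes\mathcal M^+(\mathcal I^{+,0}_{a+\ell}\otimes\mathrm{Id})\hat\Delta_0\tau$.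 **Malliavin derivative on trees.** $D_\Xi:\mathcal T_0\to\mathcal T_1$ is linear, satisfies the Leibniz rule for the tree product, and $D_\Xi\Xi_0=\Xi_1$, $D_\Xi X^k=0$, $D_\Xi\mathbf 1=0$, $D_\Xi\mathcal I_a(\tau)=\mathcal I_a(D_\Xi\tau)$. $\mathcal Q_0$ is the projection sending to zero all trees containing $\Xi_1$. **Preparation map.** A linear map $R:\mathcal T\to\mathcal T$ fixing polynomials $X^k$, noises and planted trees such that: for each tree $\tau$, $R\tau=\tau+\sum_j\lambda_j\tau_j$ (finite sum) with $\deg_1(\tau_j)\ge\deg_1(\tau)$ and $|\tau_j|_\Xi<|\tau|_\Xi$; $(R\otimes\mathrm{Id})\Delta_i=\Delta_iR$ for $i=0,1$; and $RD_\Xi=D_\Xi R$ on $\mathcal T_0$. **Models.** $K$ is the compactly supported truncation of the heat kernel, $\xi$ is the regularised (smooth) noise and $\delta\xi$ an infinitesimal (smooth) perturbation of it. For $i=0,1$, $\Pi_x^{R,i}\tau=\hat\Pi_x^{R,i}R\tau$, $\hat\Pi^{R,i}_x$ is multiplicative, $\hat\Pi_x^{R,i}X^k=(\cdot-x)^k$, $\hat\Pi_x^{R,i}\Xi_0=\xi$, $\hat\Pi_x^{R,i}\Xi_1=\delta\xi$, and $(\hat\Pi_x^{R,i}\mathcal I_a\tau)(y)=(D^aK*\Pi_x^{R,i}\tau)(y)-\sum_{|k|<\deg_i(\mathcal I_a\tau)}\frac{(y-x)^k}{k!}(D^{a+k}K*\Pi_x^{R,i}\tau)(x)$. $\delta$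 denotes the Malliavin (Fréchet) derivative with respect to $\xi$ in the direction $\delta\xi$; $R$ does not depend on $\xi$. The character $f_x^{R,i}:\mathcal T^{+,i}\to\mathbb R$ is given by $f_x^{R,i}(\mathbf 1)=1$, $f_x^{R,i}(X_j)=-x_j$, $f_x^{R,i}(\mathcal I_a^{+,i}(\tau))=-(D^aK*\Pi_x^{R,i}\tau)(x)$. Put $\gamma_{xy}^{R,i}=(f_x^{R,i}\mathcal A_i\otimes f_y^{R,i})\Delta_i^+$ and $\Gamma_{xy}^{R,i}=(\mathrm{Id}\otimes\gamma_{xy}^{R,i})\Delta_i$. Finally, for $\tau\in\mathcal T_0$, $$d\Gamma_{yx}^R\tau=\mathcal Q_0\big(\Gamma_{yx}^{R,0}\otimes f_x^{R,0}\big)\hat\Delta_0D_\Xi\tau .$$ *)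

theory Defs
  imports "HOL-Analysis.Analysis" "HOL-Library.Poly_Mapping" "HOL-Library.Multiset"
begin

section \<open>Free vector spaces and tensor products\<close>

text \<open>
  The vector space with basis \<open>'a\<close> is \<open>'a \<Rightarrow>\<^sub>0 real\<close>, and the tensor product of the spaces with
  bases \<open>'a\<close> and \<open>'b\<close> is the space with basis \<open>'a \<times> 'b\<close>. When \<open>'a\<close> is a commutative
  monoid, the library's multiplication on \<open>'a \<Rightarrow>\<^sub>0 real\<close> is the bilinear extension of the
  monoid operation \<open>+\<close> of the basis; on \<open>'a \<times> 'b\<close> this is the product of the tensor product of
  algebras.
\<close>

instantiation poly_mapping :: (type, real_vector) real_vector
begin

definition scaleR_poly_mapping :: "real \<Rightarrow> ('a \<Rightarrow>\<^sub>0 'b) \<Rightarrow> ('a \<Rightarrow>\<^sub>0 'b)" where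
  "scaleR_poly_mapping c p = Poly_Mapping.map (scaleR c) p"

instance
proof -
  have lk: "Poly_Mapping.lookup (c *\<^sub>R p) k = c *\<^sub>R Poly_Mapping.lookup p k"
    for c and p :: "'a \<Rightarrow>\<^sub>0 'b" and k
    by (simp add: scaleR_poly_mapping_def map.rep_eq when_def)
  show "OFCLASS('a \<Rightarrow>\<^sub>0 'b, real_vector_class)"
    by standard (auto intro!: poly_mapping_eqI simp: lk lookup_add scaleR_add_right scaleR_add_left)
qed

end

abbreviation bas :: "'a \<Rightarrow> 'a \<Rightarrow>\<^sub>0 real" where
  "bas t \<equiv> Poly_Mapping.single t 1"

definition lin_ext :: "('a \<Rightarrow> 'b::real_vector) \<Rightarrow> ('a \<Rightarrow>\<^sub>0 real) \<Rightarrow> 'b" where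
  "lin_ext f p = (\<Sum>t\<in>Poly_Mapping.keys p. Poly_Mapping.lookup p t *\<^sub>R f t)"

definition tensor :: "('a \<Rightarrow>\<^sub>0 real) \<Rightarrow> ('b \<Rightarrow>\<^sub>0 real) \<Rightarrow> ('a \<times> 'b) \<Rightarrow>\<^sub>0 real" (infixr \<open>\<otimes>\<close> 72) where
  "p \<otimes> q = lin_ext (\<lambda>a. lin_ext (\<lambda>b. bas (a, b)) q) p"

text \<open>The tensor product of two linear maps, each given by its values on the basis.\<close>

definition tensor_map ::
    "('a \<Rightarrow> ('c \<Rightarrow>\<^sub>0 real)) \<Rightarrow> ('b \<Rightarrow> ('d \<Rightarrow>\<^sub>0 real)) \<Rightarrow> (('a \<times> 'b) \<Rightarrow>\<^sub>0 real) \<Rightarrow> (('c \<times> 'd) \<Rightarrow>\<^sub>0 real)"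
  where "tensor_map f g = lin_ext (\<lambda>(a, b). f a \<otimes> g b)"


section \<open>Multi-indices\<close>

type_synonym midx = "nat \<times> nat"

definition wt :: "midx \<Rightarrow> nat" where
  "wt k = 2 * fst k + snd k"

definition mfact :: "midx \<Rightarrow> real" where
  "mfact k = fact (fst k) * fact (snd k)"


section \<open>Decorated trees\<close>

text \<open>
  \<open>Node k l m M\<close> is the tree \<open>X\<^sup>k \<Xi>\<^sub>0\<^sup>l \<Xi>\<^sub>1\<^sup>m \<Prod> \<I>\<^sub>a(\<tau>)\<close>, the product running over the multiset \<open>M\<close> of
  pairs \<open>(a, \<tau>)\<close>. A noise edge has decoration \<open>(\<Xi>\<^sub>j, 0)\<close> and ends in a leaf decorated by 0, so
  only the numbers \<open>l\<close> and \<open>m\<close> of such edges at the node are recorded. The restriction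
  \<open>l + m \<le> 1\<close> is imposed in \<open>dtrees\<close>; without it the tree product is total.
\<close>

datatype dtree = Node midx nat nat "(midx \<times> dtree) multiset"

lemma size_child: "(a, t) \<in># M \<Longrightarrow> size t < size (Node k l m M)"
proof -
  assume "(a, t) \<in># M"
  then obtain N where "M = add_mset (a, t) N" by (metis insert_DiffM)
  then show ?thesis by simp
qed

lemma image_mset_fundef_cong [fundef_cong]:
  "M = N \<Longrightarrow> (\<And>x. x \<in># N \<Longrightarrow> f x = g x) \<Longrightarrow> image_mset f M = image_mset g N"
  by (auto intro: image_mset_cong)

text \<open>The addition of \<open>dtree\<close> is the tree product, its zero the tree \<open>\<one>\<close>.\<close>

instantiation dtree :: comm_monoid_add
begin

definition zero_dtree :: dtree where
  "zero_dtree = Node 0 0 0 {#}"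

fun plus_dtree :: "dtree \<Rightarrow> dtree \<Rightarrow> dtree" where
  "plus_dtree (Node k l m M) (Node k' l' m' M') = Node (k + k') (l + l') (m + m') (M + M')"

instance
proof
  fix s t u :: dtree
  show "s + t + u = s + (t + u)"
    by (cases s; cases t; cases u) (simp add: ac_simps)
  show "s + t = t + s"
    by (cases s; cases t) (simp add: ac_simps)
  show "0 + s = s"
    by (cases s) (simp add: zero_dtree_def)
qed

end

definition X_pow :: "midx \<Rightarrow> dtree" where
  "X_pow k = Node k 0 0 {#}"

definition Xi0 :: dtree where
  "Xi0 = Node 0 1 0 {#}"

definition Xi1 :: dtree where
  "Xi1 = Node 0 0 1 {#}"

definition planted :: "midx \<Rightarrow> dtree \<Rightarrow> dtree" where
  "planted a t = Node 0 0 0 {#(a, t)#}"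

inductive_set dtrees :: "dtree set" where
  "l + m \<le> 1 \<Longrightarrow> (\<And>a t. (a, t) \<in># M \<Longrightarrow> t \<in> dtrees) \<Longrightarrow> Node k l m M \<in> dtrees"

definition tree_space :: "(dtree \<Rightarrow>\<^sub>0 real) set" where
  "tree_space = span (bas ` dtrees)"

function noises :: "dtree \<Rightarrow> nat" where
  "noises (Node k l m M) = l + m + (\<Sum>(a, t)\<in>#M. noises t)"
  by pat_completeness auto
termination by (relation "Wellfounded.measure size") (auto simp del: dtree.size dest: size_child)

function noises1 :: "dtree \<Rightarrow> nat" where
  "noises1 (Node k l m M) = m + (\<Sum>(a, t)\<in>#M. noises1 t)"
  by pat_completeness auto
termination by (relation "Wellfounded.measure size") (auto simp del: dtree.size dest: size_child)

lemma noises_child: "(a, t) \<in># M \<Longrightarrow> noises t \<le> noises (Node k l m M)"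
proof -
  assume "(a, t) \<in># M"
  then obtain N where "M = add_mset (a, t) N" by (metis insert_DiffM)
  then show ?thesis by simp
qed

text \<open>
  The degrees \<open>deg\<^sub>0\<close> and \<open>deg\<^sub>1\<close> in space dimension \<open>d = 1\<close>; \<open>\<alpha>\<close> is the regularity of the
  noise. They differ only on \<open>\<Xi>\<^sub>1\<close>, where \<open>deg\<^sub>0\<close> has the gain \<open>(d + 2) / 2\<close>.
\<close>

function deg :: "real \<Rightarrow> nat \<Rightarrow> dtree \<Rightarrow> real" where
  "deg \<alpha> i (Node k l m M) =
     real (wt k) + real l * \<alpha> + real m * (if i = 0 then \<alpha> + 3 / 2 else \<alpha>)
     + (\<Sum>(a, t)\<in>#M. deg \<alpha> i t + 2 - real (wt a))"
  by pat_completeness auto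
termination by (relation "Wellfounded.measure (\<lambda>(\<alpha>, i, t). size t)") (auto simp del: dtree.size dest: size_child)

text \<open>
  The trees generated by the rule of the quasilinear equation: the outgoing edges (those pointing
  away from the root) of every node, the root included, are \<open>\<Prod> \<I>(\<cdot>)\<close>, \<open>(\<Prod> \<I>(\<cdot>)) \<I>\<^sub>2(\<cdot>)\<close> or \<open>\<Xi>\<^sub>0\<close>.
\<close>

inductive_set T0 :: "dtree set" where
  noise: "Node k 1 0 {#} \<in> T0"
| prod: "image_mset fst M = replicate_mset n (0, 0)
     \<or> image_mset fst M = add_mset (0, 2) (replicate_mset n (0, 0))
     \<Longrightarrow> (\<And>a t. (a, t) \<in># M \<Longrightarrow> t \<in> T0) \<Longrightarrow> Node k 0 0 M \<in> T0"

definition T0_space :: "(dtree \<Rightarrow>\<^sub>0 real) set" where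
  "T0_space = span (bas ` T0)"

definition plant :: "midx \<Rightarrow> (dtree \<Rightarrow>\<^sub>0 real) \<Rightarrow> (dtree \<Rightarrow>\<^sub>0 real)" where
  "plant a = lin_ext (\<lambda>t. bas (planted a t))"

text \<open>\<open>D_Xi\<close> is \<open>D\<^sub>\<Xi>\<close> on a tree: the Leibniz rule written out over the factors of the tree.\<close>

function D_Xi :: "dtree \<Rightarrow> (dtree \<Rightarrow>\<^sub>0 real)" where
  "D_Xi (Node k l m M) =
     real l *\<^sub>R bas (Node k (l - 1) (m + 1) M)
     + (\<Sum>(a, t)\<in>#M. bas (Node k l m (M - {#(a, t)#})) * plant a (D_Xi t))"
  by pat_completeness auto
termination by (relation "Wellfounded.measure size") (auto simp del: dtree.size dest: size_child)

definition Q0 :: "(dtree \<Rightarrow>\<^sub>0 real) \<Rightarrow> (dtree \<Rightarrow>\<^sub>0 real)" where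
  "Q0 = lin_ext (\<lambda>t. if noises1 t = 0 then bas t else 0)"


section \<open>The algebras \<open>\<T>\<^sup>+\<^sup>,\<^sup>i\<close> and the coactions\<close>

text \<open>
  \<open>(k, N)\<close> stands for the monomial \<open>X\<^sup>k \<Prod> \<I>\<^sup>+\<^sup>,\<^sup>i\<^sub>a(\<tau>)\<close>, the product running over \<open>N\<close>; the addition of
  such pairs is the multiplication of monomials. For \<open>i = 0, 1\<close> the monomials belonging to
  \<open>\<T>\<^sup>+\<^sup>,\<^sup>i\<close> are selected by \<open>plus_basis\<close>.
\<close>

type_synonym pbasis = "midx \<times> (midx \<times> dtree) multiset"

definition plus_basis :: "real \<Rightarrow> nat \<Rightarrow> pbasis set" where
  "plus_basis \<alpha> i = {(k, N). \<forall>(a, t)\<in>#N. t \<in> dtrees \<and> deg \<alpha> i (planted a t) > 0}"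

definition plus_space :: "real \<Rightarrow> nat \<Rightarrow> (pbasis \<Rightarrow>\<^sub>0 real) set" where
  "plus_space \<alpha> i = span (bas ` plus_basis \<alpha> i)"

definition Xp :: "midx \<Rightarrow> (pbasis \<Rightarrow>\<^sub>0 real)" where
  "Xp k = bas (k, {#})"

definition Ip :: "real \<Rightarrow> nat \<Rightarrow> midx \<Rightarrow> dtree \<Rightarrow> (pbasis \<Rightarrow>\<^sub>0 real)" where
  "Ip \<alpha> i a t = (if deg \<alpha> i (planted a t) > 0 then bas (0, {#(a, t)#}) else 0)"

function Delta :: "real \<Rightarrow> nat \<Rightarrow> dtree \<Rightarrow> (dtree \<times> pbasis) \<Rightarrow>\<^sub>0 real" where
  "Delta \<alpha> i (Node k l m M) =
     (bas (X_pow (1, 0)) \<otimes> 1 + 1 \<otimes> Xp (1, 0)) ^ fst k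
     * (bas (X_pow (0, 1)) \<otimes> 1 + 1 \<otimes> Xp (0, 1)) ^ snd k
     * (bas Xi0 \<otimes> 1) ^ l * (bas Xi1 \<otimes> 1) ^ m
     * (\<Prod>(a, t)\<in>#M.
          tensor_map (\<lambda>s. bas (planted a s)) bas (Delta \<alpha> i t)
          + (\<Sum>(p, q)\<in>{(p, q). real (wt (p + q)) < deg \<alpha> i (planted a t)}.
               ((1 / mfact p) *\<^sub>R bas (X_pow p)) \<otimes> ((1 / mfact q) *\<^sub>R (Xp q * Ip \<alpha> i (a + p + q) t))))"
  by pat_completeness auto
termination by (relation "Wellfounded.measure (\<lambda>(\<alpha>, i, t). size t)") (auto simp del: dtree.size dest: size_child)

text \<open>
  \<open>Delta_plus\<close> is the coproduct \<open>\<Delta>\<^sub>i\<^sup>+\<close> on a monomial. Note \<open>(-X)\<^sup>p = (-1)\<^sup>p\<^sup>0\<^sup>+\<^sup>p\<^sup>1 X\<^sup>p\<close>, with an unweighted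
  exponent.
\<close>

definition Delta_plus :: "real \<Rightarrow> nat \<Rightarrow> pbasis \<Rightarrow> (pbasis \<times> pbasis) \<Rightarrow>\<^sub>0 real" where
  "Delta_plus \<alpha> i b =
     (Xp (1, 0) \<otimes> 1 + 1 \<otimes> Xp (1, 0)) ^ fst (fst b)
     * (Xp (0, 1) \<otimes> 1 + 1 \<otimes> Xp (0, 1)) ^ snd (fst b)
     * (\<Prod>(a, t)\<in>#snd b.
          (\<Sum>p\<in>{p. real (wt p) < deg \<alpha> i (planted a t)}.
             tensor_map (Ip \<alpha> i (a + p))
               (\<lambda>c. ((- 1) ^ (fst p + snd p) / mfact p) *\<^sub>R (Xp p * bas c)) (Delta \<alpha> i t))
          + 1 \<otimes> Ip \<alpha> i a t)"

text \<open>
  The antipode is the convolution inverse of the identity; the counit is 1 on the monomial 1 and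
  0 on all others. Setting it to zero on monomials outside \<open>\<T>\<^sup>+\<^sup>,\<^sup>i\<close> only serves to make it unique
  as a function on the whole type.
\<close>

definition is_antipode :: "real \<Rightarrow> nat \<Rightarrow> ((pbasis \<Rightarrow>\<^sub>0 real) \<Rightarrow> (pbasis \<Rightarrow>\<^sub>0 real)) \<Rightarrow> bool" where
  "is_antipode \<alpha> i A \<longleftrightarrow>
     linear A \<and>
     (\<forall>b\<in>plus_basis \<alpha> i.
        A (bas b) \<in> plus_space \<alpha> i \<and>
        lin_ext (\<lambda>(c, e). A (bas c) * bas e) (Delta_plus \<alpha> i b) = (if b = 0 then 1 else 0) \<and>
        lin_ext (\<lambda>(c, e). bas c * A (bas e)) (Delta_plus \<alpha> i b) = (if b = 0 then 1 else 0)) \<and>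
     (\<forall>b. b \<notin> plus_basis \<alpha> i \<longrightarrow> A (bas b) = 0)"

definition antipode :: "real \<Rightarrow> nat \<Rightarrow> (pbasis \<Rightarrow>\<^sub>0 real) \<Rightarrow> (pbasis \<Rightarrow>\<^sub>0 real)" where
  "antipode \<alpha> i = (THE A. is_antipode \<alpha> i A)"

text \<open>
  In \<open>hat_Delta0\<close> the sum over \<open>p\<close> with \<open>deg\<^sub>1(\<I>\<^sub>a \<tau>) \<le> |p|\<close> ranges over an infinite set but has only
  finitely many nonzero terms, because \<open>\<I>\<^sup>+\<^sup>,\<^sup>0\<close> vanishes on nonpositive degrees; hence \<open>Sum_any\<close>.
\<close>

function hat_Delta0 :: "real \<Rightarrow> dtree \<Rightarrow> (dtree \<times> pbasis) \<Rightarrow>\<^sub>0 real" where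
  "hat_Delta0 \<alpha> (Node k l m M) =
     (bas (Node k l m {#}) \<otimes> 1)
     * (\<Prod>(a, t)\<in>#M.
          tensor_map (\<lambda>s. bas (planted a s)) bas (hat_Delta0 \<alpha> t)
          - Sum_any (\<lambda>p. if deg \<alpha> 1 (planted a t) \<le> real (wt p)
              then ((1 / mfact p) *\<^sub>R bas (X_pow p))
                     \<otimes> lin_ext (\<lambda>(s, c). Ip \<alpha> 0 (a + p) s * bas c) (hat_Delta0 \<alpha> t)
              else 0))"
  by pat_completeness auto
termination by (relation "Wellfounded.measure (\<lambda>(\<alpha>, t). size t)") (auto simp del: dtree.size dest: size_child)


section \<open>Preparation maps\<close>

definition preparation_map :: "real \<Rightarrow> ((dtree \<Rightarrow>\<^sub>0 real) \<Rightarrow> (dtree \<Rightarrow>\<^sub>0 real)) \<Rightarrow> bool" where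
  "preparation_map \<alpha> R \<longleftrightarrow>
     linear R \<and> R ` tree_space \<subseteq> tree_space \<and> R ` T0_space \<subseteq> T0_space \<and>
     (\<forall>k. R (bas (X_pow k)) = bas (X_pow k)) \<and>
     R (bas Xi0) = bas Xi0 \<and> R (bas Xi1) = bas Xi1 \<and>
     (\<forall>a. \<forall>t\<in>dtrees. R (bas (planted a t)) = bas (planted a t)) \<and>
     (\<forall>t\<in>dtrees. \<forall>s\<in>Poly_Mapping.keys (R (bas t) - bas t).
        deg \<alpha> 1 s \<ge> deg \<alpha> 1 t \<and> noises s < noises t) \<and>
     (\<forall>i\<in>{0, 1}. \<forall>t\<in>dtrees.
        tensor_map (\<lambda>s. R (bas s)) bas (Delta \<alpha> i t) = lin_ext (Delta \<alpha> i) (R (bas t))) \<and>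
     (\<forall>t\<in>T0. R (D_Xi t) = lin_ext D_Xi (R (bas t)))"


section \<open>Analysis on space-time\<close>

text \<open>Points are pairs (time, space); direction 0 is time, direction 1 is space.\<close>

type_synonym pt = "real \<times> real"

definition pd :: "nat \<Rightarrow> (pt \<Rightarrow> real) \<Rightarrow> pt \<Rightarrow> real" where
  "pd j f z = (if j = 0 then deriv (\<lambda>s. f (s, snd z)) (fst z) else deriv (\<lambda>s. f (fst z, s)) (snd z))"

definition D_multi :: "midx \<Rightarrow> (pt \<Rightarrow> real) \<Rightarrow> pt \<Rightarrow> real" where
  "D_multi a f = (pd 0 ^^ fst a) ((pd 1 ^^ snd a) f)"

text \<open>\<open>C\<^sup>\<infinity>\<close> on the open set \<open>S\<close>: all iterated partial derivatives are differentiable there.\<close>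

definition smooth_fun_on :: "pt set \<Rightarrow> (pt \<Rightarrow> real) \<Rightarrow> bool" where
  "smooth_fun_on S f \<longleftrightarrow> (\<forall>js. \<forall>z\<in>S. foldr pd js f differentiable (at z))"

definition pt_pow :: "pt \<Rightarrow> midx \<Rightarrow> real" where
  "pt_pow z k = fst z ^ fst k * snd z ^ snd k"

definition heat_kernel :: "pt \<Rightarrow> real" where
  "heat_kernel z = (if fst z > 0 then exp (- (snd z)\<^sup>2 / (4 * fst z)) / sqrt (4 * pi * fst z) else 0)"

text \<open>
  Every product \<open>\<chi> \<cdot> heat_kernel\<close> with a smooth compactly supported cutoff \<open>\<chi>\<close> equal to 1 near the
  origin qualifies, and so do the usual variants with an additional smooth correction away from it.
\<close>

definition truncated_heat_kernel :: "(pt \<Rightarrow> real) \<Rightarrow> bool" where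
  "truncated_heat_kernel K \<longleftrightarrow>
     (\<exists>C. compact C \<and> (\<forall>z. z \<notin> C \<longrightarrow> K z = 0)) \<and>
     (\<exists>\<epsilon>>0. \<forall>z\<in>ball 0 \<epsilon>. K z = heat_kernel z) \<and>
     smooth_fun_on (- {0}) K"

text \<open>
  \<open>D\<^sup>a K * g\<close> for a smooth function \<open>g\<close>. As \<open>D\<^sup>a K\<close> is in general only a distribution (it need not be
  locally integrable at the origin), the derivatives are moved to \<open>g\<close>, as in the definition of the
  distributional derivative.
\<close>

definition conv :: "(pt \<Rightarrow> real) \<Rightarrow> midx \<Rightarrow> (pt \<Rightarrow> real) \<Rightarrow> pt \<Rightarrow> real" where
  "conv K a g y = (LINT z|lborel. K z * D_multi a g (y - z))"

text \<open>
  The value of the derivative at \<open>\<xi>\<close> of a functional \<open>F\<close> of the noise in the direction \<open>\<delta>\<xi>\<close>. It is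
  taken along the line \<open>\<xi> + \<epsilon> \<delta>\<xi>\<close>, so no topology on the space of smooth noises has to be fixed.
\<close>

definition malliavin :: "((pt \<Rightarrow> real) \<Rightarrow> real) \<Rightarrow> (pt \<Rightarrow> real) \<Rightarrow> (pt \<Rightarrow> real) \<Rightarrow> real" where
  "malliavin F \<xi> \<delta>\<xi> = deriv (\<lambda>\<epsilon>. F (\<lambda>z. \<xi> z + \<epsilon> * \<delta>\<xi> z)) 0"


section \<open>Models\<close>

text \<open>
  \<open>hat_Pi \<dots> x t\<close> is the function \<open>\<Pi>hat\<^sub>x\<^sup>R\<^sup>,\<^sup>i t\<close>. The inner function of \<open>z\<close> is \<open>\<Pi>\<^sub>x\<^sup>R\<^sup>,\<^sup>i t = \<Pi>hat\<^sub>x\<^sup>R\<^sup>,\<^sup>i R t\<close>, written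
  out on the basis. Since \<open>R t = t + \<Sum> \<lambda>\<^sub>j t\<^sub>j\<close> where the \<open>t\<^sub>j\<close> have fewer noises than \<open>t\<close>, the recursion
  terminates; the test \<open>s = t \<or> noises s < noises t\<close> is true for all \<open>t \<in> dtrees\<close> when \<open>R\<close> is a
  preparation map, and is there only to make the definition total in \<open>R\<close>.
\<close>

function hat_Pi :: "real \<Rightarrow> ((dtree \<Rightarrow>\<^sub>0 real) \<Rightarrow> (dtree \<Rightarrow>\<^sub>0 real)) \<Rightarrow> (pt \<Rightarrow> real) \<Rightarrow> (pt \<Rightarrow> real) \<Rightarrow>
    (pt \<Rightarrow> real) \<Rightarrow> nat \<Rightarrow> pt \<Rightarrow> dtree \<Rightarrow> pt \<Rightarrow> real" where
  "hat_Pi \<alpha> R K \<xi> \<delta>\<xi> i x (Node k l m M) = (\<lambda>y.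
     pt_pow (y - x) k * \<xi> y ^ l * \<delta>\<xi> y ^ m
     * (\<Prod>(a, t)\<in>#M.
          let P = (\<lambda>z. \<Sum>s\<in>Poly_Mapping.keys (R (bas t)).
                     if s = t \<or> noises s < noises t
                     then Poly_Mapping.lookup (R (bas t)) s * hat_Pi \<alpha> R K \<xi> \<delta>\<xi> i x s z else 0)
          in conv K a P y
             - (\<Sum>q\<in>{q. real (wt q) < deg \<alpha> i (planted a t)}.
                  pt_pow (y - x) q / mfact q * conv K (a + q) P x)))"
  by pat_completeness auto
termination
  by (relation "measures [\<lambda>(\<alpha>, R, K, \<xi>, \<delta>\<xi>, i, x, t). noises t, \<lambda>(\<alpha>, R, K, \<xi>, \<delta>\<xi>, i, x, t). size t]")
    (auto simp del: dtree.size noises.simps simp: le_eq_less_or_eq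
       dest: size_child noises_child
       intro: less_le_trans)

definition hat_Pi_lin :: "real \<Rightarrow> ((dtree \<Rightarrow>\<^sub>0 real) \<Rightarrow> (dtree \<Rightarrow>\<^sub>0 real)) \<Rightarrow> (pt \<Rightarrow> real) \<Rightarrow> (pt \<Rightarrow> real) \<Rightarrow>
    (pt \<Rightarrow> real) \<Rightarrow> nat \<Rightarrow> pt \<Rightarrow> (dtree \<Rightarrow>\<^sub>0 real) \<Rightarrow> pt \<Rightarrow> real" where
  "hat_Pi_lin \<alpha> R K \<xi> \<delta>\<xi> i x p y = lin_ext (\<lambda>t. hat_Pi \<alpha> R K \<xi> \<delta>\<xi> i x t y) p"

definition Pi_lin :: "real \<Rightarrow> ((dtree \<Rightarrow>\<^sub>0 real) \<Rightarrow> (dtree \<Rightarrow>\<^sub>0 real)) \<Rightarrow> (pt \<Rightarrow> real) \<Rightarrow> (pt \<Rightarrow> real) \<Rightarrow>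
    (pt \<Rightarrow> real) \<Rightarrow> nat \<Rightarrow> pt \<Rightarrow> (dtree \<Rightarrow>\<^sub>0 real) \<Rightarrow> pt \<Rightarrow> real" where
  "Pi_lin \<alpha> R K \<xi> \<delta>\<xi> i x p = hat_Pi_lin \<alpha> R K \<xi> \<delta>\<xi> i x (R p)"

definition f_char :: "real \<Rightarrow> ((dtree \<Rightarrow>\<^sub>0 real) \<Rightarrow> (dtree \<Rightarrow>\<^sub>0 real)) \<Rightarrow> (pt \<Rightarrow> real) \<Rightarrow> (pt \<Rightarrow> real) \<Rightarrow>
    (pt \<Rightarrow> real) \<Rightarrow> nat \<Rightarrow> pt \<Rightarrow> pbasis \<Rightarrow> real" where
  "f_char \<alpha> R K \<xi> \<delta>\<xi> i x b =
     pt_pow (- x) (fst b) * (\<Prod>(a, t)\<in>#snd b. - conv K a (Pi_lin \<alpha> R K \<xi> \<delta>\<xi> i x (bas t)) x)"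

definition gamma_char :: "real \<Rightarrow> ((dtree \<Rightarrow>\<^sub>0 real) \<Rightarrow> (dtree \<Rightarrow>\<^sub>0 real)) \<Rightarrow> (pt \<Rightarrow> real) \<Rightarrow> (pt \<Rightarrow> real) \<Rightarrow>
    (pt \<Rightarrow> real) \<Rightarrow> nat \<Rightarrow> pt \<Rightarrow> pt \<Rightarrow> pbasis \<Rightarrow> real" where
  "gamma_char \<alpha> R K \<xi> \<delta>\<xi> i x y b =
     lin_ext (\<lambda>(c, e). lin_ext (f_char \<alpha> R K \<xi> \<delta>\<xi> i x) (antipode \<alpha> i (bas c)) * f_char \<alpha> R K \<xi> \<delta>\<xi> i y e)
       (Delta_plus \<alpha> i b)"

definition Gamma :: "real \<Rightarrow> ((dtree \<Rightarrow>\<^sub>0 real) \<Rightarrow> (dtree \<Rightarrow>\<^sub>0 real)) \<Rightarrow> (pt \<Rightarrow> real) \<Rightarrow> (pt \<Rightarrow> real) \<Rightarrow>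
    (pt \<Rightarrow> real) \<Rightarrow> nat \<Rightarrow> pt \<Rightarrow> pt \<Rightarrow> dtree \<Rightarrow> (dtree \<Rightarrow>\<^sub>0 real)" where
  "Gamma \<alpha> R K \<xi> \<delta>\<xi> i x y t =
     lin_ext (\<lambda>(s, b). gamma_char \<alpha> R K \<xi> \<delta>\<xi> i x y b *\<^sub>R bas s) (Delta \<alpha> i t)"

text \<open>\<open>d_Gamma \<dots> y x p\<close> is \<open>d\<Gamma>\<^sub>y\<^sub>x\<^sup>R p\<close>.\<close>

definition d_Gamma :: "real \<Rightarrow> ((dtree \<Rightarrow>\<^sub>0 real) \<Rightarrow> (dtree \<Rightarrow>\<^sub>0 real)) \<Rightarrow> (pt \<Rightarrow> real) \<Rightarrow> (pt \<Rightarrow> real) \<Rightarrow>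
    (pt \<Rightarrow> real) \<Rightarrow> pt \<Rightarrow> pt \<Rightarrow> (dtree \<Rightarrow>\<^sub>0 real) \<Rightarrow> (dtree \<Rightarrow>\<^sub>0 real)" where
  "d_Gamma \<alpha> R K \<xi> \<delta>\<xi> y x p =
     Q0 (lin_ext (\<lambda>(s, b). f_char \<alpha> R K \<xi> \<delta>\<xi> 0 x b *\<^sub>R Gamma \<alpha> R K \<xi> \<delta>\<xi> 0 y x s)
          (lin_ext (hat_Delta0 \<alpha>) (lin_ext D_Xi p)))"

text \<open>
  \<open>delta_hat_Pi\<close> is \<open>\<delta>\<Pi>hat\<^sub>x\<^sup>R\<^sup>,\<^sup>1\<close>: only the first noise argument is varied. It is used on \<open>\<T>\<^sub>0\<close>, where
  \<open>\<Pi>hat\<^sub>x\<^sup>R\<^sup>,\<^sup>1\<close> does not depend on the interpretation \<open>\<delta>\<xi>\<close> of \<open>\<Xi>\<^sub>1\<close>.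
\<close>

definition delta_hat_Pi :: "real \<Rightarrow> ((dtree \<Rightarrow>\<^sub>0 real) \<Rightarrow> (dtree \<Rightarrow>\<^sub>0 real)) \<Rightarrow> (pt \<Rightarrow> real) \<Rightarrow> (pt \<Rightarrow> real) \<Rightarrow>
    (pt \<Rightarrow> real) \<Rightarrow> pt \<Rightarrow> (dtree \<Rightarrow>\<^sub>0 real) \<Rightarrow> pt \<Rightarrow> real" where
  "delta_hat_Pi \<alpha> R K \<xi> \<delta>\<xi> x p z = malliavin (\<lambda>\<eta>. hat_Pi_lin \<alpha> R K \<eta> \<delta>\<xi> 1 x p z) \<xi> \<delta>\<xi>"

definition F_hat :: "real \<Rightarrow> ((dtree \<Rightarrow>\<^sub>0 real) \<Rightarrow> (dtree \<Rightarrow>\<^sub>0 real)) \<Rightarrow> (pt \<Rightarrow> real) \<Rightarrow> (pt \<Rightarrow> real) \<Rightarrow>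
    (pt \<Rightarrow> real) \<Rightarrow> pt \<Rightarrow> pt \<Rightarrow> (dtree \<Rightarrow>\<^sub>0 real) \<Rightarrow> pt \<Rightarrow> real" where
  "F_hat \<alpha> R K \<xi> \<delta>\<xi> x y p z =
     delta_hat_Pi \<alpha> R K \<xi> \<delta>\<xi> x p z - hat_Pi_lin \<alpha> R K \<xi> \<delta>\<xi> 1 y (d_Gamma \<alpha> R K \<xi> \<delta>\<xi> y x p) z"

end

(*
  For every tree t the second spatial derivative of the function modelled by I(t) is the function
  modelled by I_2(t): the derivative passes through the convolution, and the subtracted Taylor
  polynomial of I(t) turns into that of I_2(t), because it sends X^q/q! to X^(q-2)/(q-2)! and the
  degree drops by 2. Along the line xi + eps * dxi the model is a polynomial in eps with smooth
  coefficients, so the Malliavin derivative is the coefficient of eps and commutes with the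
  spatial derivative. In d Gamma I(tau) only planted trees I(t) and monomials X^q/q! occur, and
  replacing each of them as above gives d Gamma I_2(tau) term by term. The coefficients are left
  untouched by this, so that no property of the characters f and gamma or of the antipode enters.
*)

theory Submission
  imports Defs
begin

section \<open>Smooth functions\<close>

text \<open>In each of the three subtracted sums (the Taylor polynomial in \<open>hat_Pi\<close> and
  the sums in \<open>Delta\<close> and \<open>hat_Delta0\<close>) the coefficient of X^p/p! involves
  \<open>a\<close> and \<open>p\<close> only through a + p, and the cutoff compares |p|, in
  \<open>Delta\<close> together with the second index, with deg(t) + 2 - |a|. Passing from a = 0 to
  a = (0, 2) is therefore the reindexing p -> p + (0, 2). Indices missed by this shift have spatial
  exponent below 2, so two spatial derivatives kill their monomials. The monomials produced by
  \<open>hat_Delta0\<close> are then hit by \<open>Gamma\<close>; there the coefficient of X^q/q! in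
  the image of X^p/p! depends on p - q alone and survives a shift of both indices. The analytic
  obstacle is that \<open>deriv\<close> is total, so a formal derivative rule means nothing without
  differentiability. Smoothness therefore accompanies every identity, and identities are kept
  between functions on all of space-time; the evaluation at y comes last.\<close>

abbreviation smooth :: "(pt \<Rightarrow> real) \<Rightarrow> bool" where
  "smooth \<equiv> smooth_fun_on UNIV"

lemma smooth_imp_differentiable: "smooth f \<Longrightarrow> f differentiable (at z)"
  unfolding smooth_fun_on_def by (drule spec[of _ "[]"]) (simp del: split_paired_All)

lemma smooth_pd: "smooth f \<Longrightarrow> smooth (pd j f)"
  unfolding smooth_fun_on_def
proof (intro allI ballI)
  fix js z
  assume "\<forall>js. \<forall>z\<in>UNIV. foldr pd js f differentiable at z"
  from this[rule_format, of z "js @ [j]"] show "foldr pd js (pd j f) differentiable at z"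
    by simp
qed

text \<open>Smoothness is proved by exhibiting a class of differentiable functions that is stable
  under \<open>pd\<close>. No formula for iterated derivatives is then required.\<close>

lemma smooth_coinduct:
  assumes "P f"
    and diff: "\<And>f z. P f \<Longrightarrow> f differentiable (at z)"
    and step: "\<And>f j. P f \<Longrightarrow> P (pd j f)"
  shows "smooth f"
proof -
  have "P (foldr pd js f)" for js
    by (induction js) (auto simp: assms)
  then show ?thesis
    by (simp add: smooth_fun_on_def diff)
qed

text \<open>Chain rule along the two coordinate lines through z. It moves every rule for
  \<open>pd\<close> from one-variable \<open>deriv\<close> to the Frechet derivative, where the
  library rules apply.\<close>

lemma pd_eq_derivative:
  assumes "(f has_derivative f') (at z)"
  shows "pd j f z = f' (if j = 0 then (1, 0) else (0, 1))"
proof -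
  interpret f': bounded_linear f'
    using assms by (rule has_derivative_bounded_linear)
  obtain a b where z: "z = (a, b)"
    by force
  have "((\<lambda>s. f (s, b)) has_derivative (\<lambda>h. f' (h, 0))) (at a)"
    by (rule has_derivative_compose[of "\<lambda>s. (s, b)" "\<lambda>h. (h, 0)" a UNIV f f'])
      (use assms z in \<open>auto intro!: derivative_eq_intros\<close>)
  moreover have "(\<lambda>h. f' (h, 0)) = (*) (f' (1, 0))"
  proof
    show "f' (h, 0) = f' (1, 0) * h" for h
      using f'.scaleR[of h "(1, 0)"] by simp
  qed
  ultimately have 1: "DERIV (\<lambda>s. f (s, b)) a :> f' (1, 0)"
    by (simp add: has_field_derivative_def)
  have "((\<lambda>s. f (a, s)) has_derivative (\<lambda>h. f' (0, h))) (at b)"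
    by (rule has_derivative_compose[of "\<lambda>s. (a, s)" "\<lambda>h. (0, h)" b UNIV f f'])
      (use assms z in \<open>auto intro!: derivative_eq_intros\<close>)
  moreover have "(\<lambda>h. f' (0, h)) = (*) (f' (0, 1))"
  proof
    show "f' (0, h) = f' (0, 1) * h" for h
      using f'.scaleR[of h "(0, 1)"] by simp
  qed
  ultimately have 2: "DERIV (\<lambda>s. f (a, s)) b :> f' (0, 1)"
    by (simp add: has_field_derivative_def)
  show ?thesis
    using 1 2 z by (simp add: pd_def DERIV_imp_deriv)
qed

lemma has_derivative_pd:
  assumes "f differentiable (at z)"
  shows "(f has_derivative (\<lambda>h. fst h * pd 0 f z + snd h * pd 1 f z)) (at z)"
proof -
  obtain f' where f': "(f has_derivative f') (at z)"
    using assms by (auto simp: differentiable_def)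
  interpret f': bounded_linear f'
    using f' by (rule has_derivative_bounded_linear)
  have "f' = (\<lambda>h. fst h * pd 0 f z + snd h * pd 1 f z)"
  proof
    fix h :: pt
    have "h = fst h *\<^sub>R (1, 0) + snd h *\<^sub>R (0, 1)"
      by (simp add: prod_eq_iff)
    then have "f' h = f' (fst h *\<^sub>R (1, 0) + snd h *\<^sub>R (0, 1))"
      by simp
    also have "\<dots> = fst h * f' (1, 0) + snd h * f' (0, 1)"
      by (simp only: f'.add f'.scaleR real_scaleR_def)
    finally show "f' h = fst h * pd 0 f z + snd h * pd 1 f z"
      by (simp add: pd_eq_derivative[OF f'])
  qed
  with f' show ?thesis
    by simp
qed

lemma smooth_imp_continuous_on: "smooth f \<Longrightarrow> continuous_on S f"
  by (intro continuous_at_imp_continuous_on ballI differentiable_imp_continuous_within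
      smooth_imp_differentiable)

section \<open>Calculus rules for partial derivatives\<close>

lemma pd_const: "pd j (\<lambda>z. c) = (\<lambda>z. 0)"
  by (auto simp: pd_def)

lemma pd_add:
  assumes "smooth f" "smooth g"
  shows "pd j (\<lambda>z. f z + g z) = (\<lambda>z. pd j f z + pd j g z)"
proof
  fix z
  show "pd j (\<lambda>z. f z + g z) z = pd j f z + pd j g z"
    using pd_eq_derivative[OF has_derivative_add[OF has_derivative_pd has_derivative_pd], of f z g j]
    by (auto simp: assms smooth_imp_differentiable pd_def)
qed

lemma pd_mult:
  assumes "f differentiable (at z)" "g differentiable (at z)"
  shows "pd j (\<lambda>z. f z * g z) z = f z * pd j g z + pd j f z * g z"
  using pd_eq_derivative[OF has_derivative_mult[OF has_derivative_pd has_derivative_pd], of f z g j]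
  by (auto simp: assms pd_def)

lemma pd_cmult: "smooth f \<Longrightarrow> pd j (\<lambda>z. c * f z) = (\<lambda>z. c * pd j f z)"
  using pd_mult[of "\<lambda>_. c" _ f j] by (auto simp: pd_const smooth_imp_differentiable)

lemma smooth_const [simp]: "smooth (\<lambda>z. c)"
  by (rule smooth_coinduct[where P = "\<lambda>f. \<exists>c. f = (\<lambda>z. c)"]) (auto simp: pd_const)

text \<open>The Leibniz rule turns one product into a sum of two, so products of smooth functions
  alone are not stable under \<open>pd\<close>. This closure is, and hence can serve as the class in
  \<open>smooth_coinduct\<close>.\<close>

inductive smooth_alg :: "(pt \<Rightarrow> real) \<Rightarrow> bool" where
  base: "smooth f \<Longrightarrow> smooth_alg f"
| add: "smooth_alg f \<Longrightarrow> smooth_alg g \<Longrightarrow> smooth_alg (\<lambda>z. f z + g z)"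
| mult: "smooth_alg f \<Longrightarrow> smooth_alg g \<Longrightarrow> smooth_alg (\<lambda>z. f z * g z)"

lemma smooth_alg_step: "smooth_alg f \<Longrightarrow> (\<forall>z. f differentiable (at z)) \<and> (\<forall>j. smooth_alg (pd j f))"
proof (induction rule: smooth_alg.induct)
  case (base f)
  then show ?case
    by (simp add: smooth_alg.base smooth_pd smooth_imp_differentiable)
next
  case (add f g)
  have "pd j (\<lambda>z. f z + g z) = (\<lambda>z. pd j f z + pd j g z)" for j
  proof
    fix z
    show "pd j (\<lambda>z. f z + g z) z = pd j f z + pd j g z"
      using pd_eq_derivative[OF has_derivative_add[OF has_derivative_pd has_derivative_pd], of f z g j]
      by (auto simp: add pd_def)
  qed
  with add show ?case
    by (auto intro: smooth_alg.intros)
next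
  case (mult f g)
  have "pd j (\<lambda>z. f z * g z) = (\<lambda>z. f z * pd j g z + pd j f z * g z)" for j
    by (rule ext, rule pd_mult) (auto simp: mult)
  with mult show ?case
    by (auto intro!: smooth_alg.add smooth_alg.mult)
qed

lemma smooth_alg_imp_smooth: "smooth_alg f \<Longrightarrow> smooth f"
  by (rule smooth_coinduct[of smooth_alg]) (auto dest: smooth_alg_step)

lemma smooth_add: "smooth f \<Longrightarrow> smooth g \<Longrightarrow> smooth (\<lambda>z. f z + g z)"
  and smooth_mult: "smooth f \<Longrightarrow> smooth g \<Longrightarrow> smooth (\<lambda>z. f z * g z)"
  by (rule smooth_alg_imp_smooth, rule smooth_alg.add smooth_alg.mult; rule smooth_alg.base; assumption)+

lemma smooth_cmult: "smooth f \<Longrightarrow> smooth (\<lambda>z. c * f z)"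
  by (intro smooth_mult smooth_const)

lemma smooth_power: "smooth f \<Longrightarrow> smooth (\<lambda>z. f z ^ n)"
  by (induction n) (simp_all add: smooth_mult)

lemma smooth_coord: "smooth (\<lambda>z. fst z - c)" "smooth (\<lambda>z. snd z - c)"
proof -
  have *: "(\<lambda>z. fst z - c) differentiable (at z)" "(\<lambda>z. snd z - c) differentiable (at z)" for z :: pt
    by (intro differentiable_diff differentiable_const
        bounded_linear_imp_differentiable[OF bounded_linear_fst]
        bounded_linear_imp_differentiable[OF bounded_linear_snd])+
  have **: "pd j (\<lambda>z. fst z - c) = (\<lambda>z. if j = 0 then 1 else 0)"
    "pd j (\<lambda>z. snd z - c) = (\<lambda>z. if j = 0 then 0 else 1)" for j
    by (simp_all add: pd_def fun_eq_iff)
  let ?P = "\<lambda>f :: pt \<Rightarrow> real. f = (\<lambda>z. fst z - c) \<or> f = (\<lambda>z. snd z - c) \<or> (\<exists>c. f = (\<lambda>z. c))"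
  have "smooth f" if "?P f" for f
    by (rule smooth_coinduct[of ?P, OF that]) (auto simp: * ** pd_const)
  then show "smooth (\<lambda>z. fst z - c)" "smooth (\<lambda>z. snd z - c)"
    by blast+
qed

lemma smooth_pt_pow: "smooth (\<lambda>z. pt_pow (z - x) k)"
  unfolding pt_pow_def by (intro smooth_mult smooth_power) (simp_all add: smooth_coord)

lemma smooth_D_multi: "smooth f \<Longrightarrow> smooth (D_multi a f)"
proof -
  have "smooth ((pd j ^^ n) f)" if "smooth f" for j n f
    using that by (induction n) (auto intro: smooth_pd)
  then show "smooth f \<Longrightarrow> smooth (D_multi a f)"
    by (simp add: D_multi_def)
qed

lemma D_multi_add:
  assumes "smooth f" "smooth g"
  shows "D_multi a (\<lambda>z. f z + g z) = (\<lambda>z. D_multi a f z + D_multi a g z)"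
proof -
  have "smooth ((pd j ^^ n) f) \<and> smooth ((pd j ^^ n) g) \<and>
      (pd j ^^ n) (\<lambda>z. f z + g z) = (\<lambda>z. (pd j ^^ n) f z + (pd j ^^ n) g z)"
    if "smooth f" "smooth g" for j n f g
    using that by (induction n) (auto intro: smooth_pd simp: pd_add)
  with assms show ?thesis
    by (simp add: D_multi_def)
qed

lemma D_multi_cmult:
  assumes "smooth f"
  shows "D_multi a (\<lambda>z. c * f z) = (\<lambda>z. c * D_multi a f z)"
proof -
  have "smooth ((pd j ^^ n) f) \<and> (pd j ^^ n) (\<lambda>z. c * f z) = (\<lambda>z. c * (pd j ^^ n) f z)"
    if "smooth f" for j n f
    using that by (induction n) (auto intro: smooth_pd simp: pd_cmult)
  with assms show ?thesis
    by (simp add: D_multi_def)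
qed

section \<open>Convolution with an integrable kernel of compact support\<close>

text \<open>Since \<open>conv\<close> puts every derivative on the smooth function, integrability
  and bounded support of K suffice for \<open>conv K a g\<close> to be smooth.\<close>

locale kernel =
  fixes K :: "pt \<Rightarrow> real"
  assumes integrable_K: "integrable lborel K"
    and bounded_support_K: "\<exists>r. \<forall>z. z \<notin> cball 0 r \<longrightarrow> K z = 0"
begin

text \<open>Where K does not vanish, y - z stays in a compact ball, on which g is bounded; a
  multiple of K dominates.\<close>

lemma integrable_conv:
  assumes "continuous_on UNIV g"
  shows "integrable lborel (\<lambda>z. K z * g (y - z))"
proof -
  obtain r where r: "K z = 0" if "z \<notin> cball 0 r" for z
    using bounded_support_K by blast
  have cont: "continuous_on S (\<lambda>z. g (y - z))" for S
    by (intro continuous_on_compose2[OF assms] continuous_intros) auto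
  have "compact ((\<lambda>z. g (y - z)) ` cball 0 r)"
    by (intro compact_continuous_image cont compact_cball)
  then obtain B where B: "\<bar>g (y - z)\<bar> \<le> B" if "z \<in> cball 0 r" for z
    by (force dest: compact_imp_bounded simp: bounded_iff)
  show ?thesis
  proof (rule Bochner_Integration.integrable_bound)
    show "integrable lborel (\<lambda>z. B * K z)"
      using integrable_K by simp
    show "(\<lambda>z. K z * g (y - z)) \<in> borel_measurable lborel"
      using borel_measurable_times[of K borel, OF _ borel_measurable_continuous_onI[OF cont]]
        borel_measurable_integrable[OF integrable_K] by simp
    have "norm (K z * g (y - z)) \<le> norm (B * K z)" for z
    proof (cases "z \<in> cball 0 r")
      case True
      have "\<bar>g (y - z)\<bar> * \<bar>K z\<bar> \<le> \<bar>B\<bar> * \<bar>K z\<bar>"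
        by (intro mult_right_mono order_trans[OF B[OF True]]) auto
      then show ?thesis
        by (simp add: abs_mult mult.commute)
    next
      case False
      then show ?thesis
        using r by simp
    qed
    then show "AE z in lborel. norm (K z * g (y - z)) \<le> norm (B * K z)"
      by simp
  qed
qed

lemma conv_0: "conv K 0 g y = (LINT z|lborel. K z * g (y - z))"
  by (simp add: conv_def D_multi_def)

lemma conv_eq_conv_0: "conv K a g = conv K 0 (D_multi a g)"
  by (rule ext) (simp add: conv_def D_multi_def)

text \<open>The first-order remainder is small uniformly in the base point w because the partial
  derivatives are uniformly continuous on a compact ball. Uniformity is what allows the estimate to
  be integrated against K.\<close>

lemma taylor_uniform:
  assumes "smooth g" "e > 0"
  obtains d where "d > 0"
    "\<And>w h. w \<in> cball y r \<Longrightarrow> norm h < d \<Longrightarrow>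
      \<bar>g (w + h) - g w - (fst h * pd 0 g w + snd h * pd 1 g w)\<bar> \<le> e * norm h"
proof -
  \<comment> \<open>The radius exceeds r by 1 so that the ball of radius d' \<le> 1 around any w in
    \<open>cball y r\<close> stays inside.\<close>
  have "uniformly_continuous_on (cball y (r + 1)) (pd j g)" for j
    by (intro compact_uniformly_continuous smooth_imp_continuous_on smooth_pd assms compact_cball)
  then have "\<exists>d>0. \<forall>u\<in>cball y (r + 1). \<forall>w\<in>cball y (r + 1). dist w u < d \<longrightarrow>
      dist (pd j g w) (pd j g u) < e / 2" for j
    using \<open>e > 0\<close> unfolding uniformly_continuous_on_def
    by (metis half_gt_zero)
  then obtain d where d: "d j > 0" "\<lbrakk>u \<in> cball y (r + 1); w \<in> cball y (r + 1); dist w u < d j\<rbrakk>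
      \<Longrightarrow> dist (pd j g w) (pd j g u) < e / 2" for j u w
    by metis
  define d' where "d' = min 1 (min (d 0) (d 1))"
  show thesis
  proof
    show "d' > 0"
      using d(1) by (simp add: d'_def)
    fix w h :: pt
    assume w: "w \<in> cball y r" and h: "norm h < d'"
    define g' where "g' = (\<lambda>u h. fst h * pd 0 g u + snd h * pd 1 g u)"
    have "norm (g (w + h) - g w - g' w ((w + h) - w)) \<le> norm ((w + h) - w) * e"
    proof (rule differentiable_bound_linearization[where S = "ball w d'"])
      show "w \<in> ball w d'"
        using \<open>d' > 0\<close> by simp
      show "w + t *\<^sub>R (w + h - w) \<in> ball w d'" if "t \<in> {0..1}" for t
      proof -
        have "\<bar>t\<bar> * norm h \<le> 1 * norm h"
          using that by (intro mult_right_mono) auto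
        then show ?thesis
          using h by (simp add: dist_norm)
      qed
      show "(g has_derivative g' u) (at u within ball w d')" for u
        unfolding g'_def
        by (rule has_derivative_at_withinI, rule has_derivative_pd, rule smooth_imp_differentiable, rule assms)
      show "onorm (g' u - g' w) \<le> e" if u: "u \<in> ball w d'" for u
      proof (rule onorm_bound)
        have "dist y u \<le> dist y w + dist w u"
          by (rule dist_triangle)
        then have "u \<in> cball y (r + 1)" "w \<in> cball y (r + 1)"
          using u w by (auto simp: d'_def)
        then have *: "\<bar>pd j g u - pd j g w\<bar> \<le> e / 2" if "j \<in> {0, 1}" for j
          using u that d(2)[of w u j] by (auto simp: d'_def dist_norm norm_minus_commute)
        show "norm ((g' u - g' w) h) \<le> e * norm h" for h :: pt
        proof -
          have "norm ((g' u - g' w) h)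
              = \<bar>fst h * (pd 0 g u - pd 0 g w) + snd h * (pd 1 g u - pd 1 g w)\<bar>"
            by (simp add: g'_def algebra_simps)
          also have "\<dots> \<le> \<bar>fst h\<bar> * \<bar>pd 0 g u - pd 0 g w\<bar> + \<bar>snd h\<bar> * \<bar>pd 1 g u - pd 1 g w\<bar>"
            by (metis abs_mult abs_triangle_ineq)
          also have "\<dots> \<le> norm h * (e / 2) + norm h * (e / 2)"
            using norm_fst_le[of "fst h" "snd h"] norm_snd_le[of "snd h" "fst h"]
            by (intro add_mono mult_mono *) auto
          finally show ?thesis
            by (simp add: mult.commute)
        qed
      qed (use \<open>e > 0\<close> in auto)
    qed
    then show "\<bar>g (w + h) - g w - (fst h * pd 0 g w + snd h * pd 1 g w)\<bar> \<le> e * norm h"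
      by (simp add: g'_def mult.commute)
  qed
qed

text \<open>Differentiation under the integral: the remainder for \<open>conv K 0 g\<close> is the
  integral of K against the Taylor remainder of g at y - z, which lies in \<open>cball y r\<close>
  whenever K z is nonzero.\<close>

lemma has_derivative_conv:
  assumes "smooth g"
  shows "(conv K 0 g has_derivative
    (\<lambda>h. fst h * conv K 0 (pd 0 g) y + snd h * conv K 0 (pd 1 g) y)) (at y)"
    (is "(_ has_derivative ?L) _")
  unfolding has_derivative_at_alt
proof (intro conjI allI impI)
  show "bounded_linear ?L"
    by (intro bounded_linear_add bounded_linear_compose[OF bounded_linear_mult_left]
        bounded_linear_fst bounded_linear_snd)
  obtain r where r: "K z = 0" if "z \<notin> cball 0 r" for z
    using bounded_support_K by blast
  fix e :: real assume "e > 0"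
  define I where "I = (LINT z|lborel. \<bar>K z\<bar>)"
  have "I \<ge> 0"
    by (simp add: I_def)
  \<comment> \<open>I is the L1 norm of K. The final bound is I * e' * norm h; the summand 1 keeps
    the quotient defined when I = 0.\<close>
  define e' where "e' = e / (I + 1)"
  have "e' > 0"
    using \<open>I \<ge> 0\<close> \<open>e > 0\<close> by (simp add: e'_def)
  obtain d where d: "d > 0"
    "\<And>w h. w \<in> cball y r \<Longrightarrow> norm h < d \<Longrightarrow>
      \<bar>g (w + h) - g w - (fst h * pd 0 g w + snd h * pd 1 g w)\<bar> \<le> e' * norm h"
    using taylor_uniform[OF assms \<open>e' > 0\<close>] by blast
  have int: "integrable lborel (\<lambda>z. K z * g (v - z))"
    "integrable lborel (\<lambda>z. K z * pd j g (v - z))" for v j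
    using assms by (auto intro!: integrable_conv smooth_imp_continuous_on smooth_pd)
  have "norm (conv K 0 g v - conv K 0 g y - ?L (v - y)) \<le> e * norm (v - y)"
    if v: "norm (v - y) < d" for v
  proof -
    define h where "h = v - y"
    have v_eq: "v - z = (y - z) + h" for z
      by (simp add: h_def)
    define E where "E = (\<lambda>z. g ((y - z) + h) - g (y - z) - (fst h * pd 0 g (y - z) + snd h * pd 1 g (y - z)))"
    have eq: "(\<lambda>z. K z * E z) = (\<lambda>z. K z * g (v - z) - K z * g (y - z)
        - (fst h * (K z * pd 0 g (y - z)) + snd h * (K z * pd 1 g (y - z))))"
      by (simp add: E_def v_eq algebra_simps)
    have int_E: "integrable lborel (\<lambda>z. K z * E z)"
      unfolding eq using int by (intro Bochner_Integration.integrable_diff Bochner_Integration.integrable_add integrable_mult_right) auto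
    have "conv K 0 g v - conv K 0 g y - ?L h = (LINT z|lborel. K z * E z)"
      unfolding eq using int by (simp add: conv_0)
    also have "norm \<dots> \<le> (LINT z|lborel. norm (K z * E z))"
      by (rule integral_norm_bound)
    also have "\<dots> \<le> (LINT z|lborel. \<bar>K z\<bar> * (e' * norm h))"
    proof (rule integral_mono)
      show "integrable lborel (\<lambda>z. norm (K z * E z))"
        by (rule integrable_norm[OF int_E])
      show "integrable lborel (\<lambda>z. \<bar>K z\<bar> * (e' * norm h))"
        by (intro integrable_mult_left integrable_abs integrable_K)
      show "norm (K z * E z) \<le> \<bar>K z\<bar> * (e' * norm h)" for z
      proof (cases "z \<in> cball 0 r")
        case True
        then have "y - z \<in> cball y r"
          by (simp add: dist_norm)
        then have "\<bar>E z\<bar> \<le> e' * norm h"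
          using v unfolding E_def by (intro d(2)) (auto simp: h_def)
        then show ?thesis
          unfolding real_norm_def abs_mult by (rule mult_left_mono) simp
      next
        case False
        then show ?thesis
          using r by simp
      qed
    qed
    also have "\<dots> = I * e' * norm h"
      by (simp add: I_def)
    also have "\<dots> \<le> e * norm h"
      using \<open>I \<ge> 0\<close> \<open>e > 0\<close> by (intro mult_right_mono) (auto simp: e'_def field_simps)
    finally show ?thesis
      by (simp add: h_def)
  qed
  then show "\<exists>d>0. \<forall>v. norm (v - y) < d \<longrightarrow>
      norm (conv K 0 g v - conv K 0 g y - ?L (v - y)) \<le> e * norm (v - y)"
    using \<open>d > 0\<close> by blast
qed

lemma pd_conv_0:
  assumes "smooth g"
  shows "pd j (conv K 0 g) = conv K 0 (pd j g)"
proof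
  \<comment> \<open>\<open>pd j\<close> is the spatial derivative for every nonzero j, not only for
    j = 1.\<close>
  have "pd j g = pd 1 g" if "j \<noteq> 0"
    using that by (auto simp: pd_def)
  then show "pd j (conv K 0 g) y = conv K 0 (pd j g) y" for y
    by (auto simp: pd_eq_derivative[OF has_derivative_conv[OF assms]])
qed

lemma smooth_conv:
  assumes "smooth g"
  shows "smooth (conv K a g)"
proof -
  have "smooth (conv K 0 g)" if "smooth g" for g
  proof (rule smooth_coinduct[where P = "\<lambda>f. \<exists>g. smooth g \<and> f = conv K 0 g"])
    show "f differentiable (at z)" if "\<exists>g. smooth g \<and> f = conv K 0 g" for f z
      using that has_derivative_conv unfolding differentiable_def by blast
    show "\<exists>g. smooth g \<and> pd j f = conv K 0 g" if "\<exists>g. smooth g \<and> f = conv K 0 g" for f j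
      using that pd_conv_0 smooth_pd by metis
  qed (use that in blast)
  then show ?thesis
    using assms by (subst conv_eq_conv_0) (blast intro: smooth_D_multi)
qed

lemma conv_add:
  assumes "smooth f" "smooth g"
  shows "conv K a (\<lambda>z. f z + g z) y = conv K a f y + conv K a g y"
  using assms integrable_conv[OF smooth_imp_continuous_on[OF smooth_D_multi]]
  by (simp add: conv_def D_multi_add distrib_left)

lemma conv_cmult: "smooth f \<Longrightarrow> conv K a (\<lambda>z. c * f z) y = c * conv K a f y"
  by (simp add: conv_def D_multi_cmult mult.left_commute)

end

text \<open>The singularity at the origin is the only threat to integrability. Away from it K is
  continuous on a compact set, hence bounded; the small ball is controlled by an integrable function
  on the box around it.\<close>

lemma truncated_heat_kernel_imp_kernel:
  assumes "truncated_heat_kernel K"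
  shows "kernel K"
proof
  have ex_C: "\<exists>C. compact C \<and> (\<forall>z. z \<notin> C \<longrightarrow> K z = 0)"
    and ex_e: "\<exists>e>0. \<forall>z\<in>ball 0 e. K z = heat_kernel z"
    and K: "smooth_fun_on (- {0}) K"
    using assms by (simp_all only: truncated_heat_kernel_def)
  from ex_C obtain C where C: "compact C" "\<And>z. z \<notin> C \<Longrightarrow> K z = 0"
    by (elim exE conjE) (simp del: split_paired_All)
  from ex_e obtain e where e: "e > 0" "\<And>z. z \<in> ball 0 e \<Longrightarrow> K z = heat_kernel z"
    by (elim exE conjE) (simp del: split_paired_All)
  obtain r where r: "\<And>z. z \<in> C \<Longrightarrow> norm z \<le> r"
    using compact_imp_bounded[OF C(1)] by (auto simp: bounded_iff simp del: split_paired_All)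
  have "K z = 0" if "z \<notin> cball 0 r" for z
    using C(2)[of z] r[of z] that by (cases "z \<in> C") simp_all
  then show "\<exists>r. \<forall>z. z \<notin> cball 0 r \<longrightarrow> K z = 0"
    by meson
  have "K differentiable (at z)" if "z \<in> - {0}" for z
    using K that unfolding smooth_fun_on_def by (drule_tac spec[of _ "[]"]) (auto simp del: split_paired_All)
  then have cont: "continuous_on (- {0}) K"
    by (intro continuous_at_imp_continuous_on ballI differentiable_imp_continuous_within)
  \<comment> \<open>K is continuous off a single point, hence Borel whatever its value
    there.\<close>
  have meas: "K \<in> borel_measurable borel"
    by (rule borel_measurable_continuous_countable_exceptions[OF _ cont]) simp
  have "compact (K ` (C - ball 0 e))"
    using e(1) by (intro compact_continuous_image continuous_on_subset[OF cont] compact_diff C) auto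
  then obtain B where B: "B > 0" "\<And>z. z \<in> C - ball 0 e \<Longrightarrow> \<bar>K z\<bar> \<le> B"
    by (auto dest!: compact_imp_bounded simp: bounded_pos simp del: split_paired_All)

  \<comment> \<open>Near the origin the heat kernel is dominated by \<open>t\<^sup>-\<^sup>1\<^sup>/\<^sup>2\<close>, uniformly in space.\<close>
  define h where "h = (\<lambda>t. indicator {0..e} t * t powr (- 1 / 2) :: real)"
  have "integrable lebesgue h"
    unfolding h_def using e(1)
    by (intro nonnegative_absolutely_integrable_1[unfolded set_integrable_def, simplified real_scaleR_def]
        integrable_on_powr_from_0) auto
  moreover have "h \<in> borel_measurable borel"
    by (simp add: h_def)
  ultimately have h: "integrable lborel h"
    by (simp add: integrable_completion)
  define g where "g = (\<lambda>(t, s). h t * indicator {- e..e} s :: real)"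
  have "integrable (lborel \<Otimes>\<^sub>M lborel) g"
  proof (rule lborel_pair.Fubini_integrable)
    show "g \<in> borel_measurable (lborel \<Otimes>\<^sub>M lborel)"
      unfolding g_def h_def by measurable
    have "(\<lambda>t. LINT s|lborel. norm (g (t, s))) = (\<lambda>t. h t * (LINT s|lborel. indicator {- e..e} s))"
      by (simp add: g_def h_def abs_mult)
    then show "integrable lborel (\<lambda>t. LINT s|lborel. norm (g (t, s)))"
      using h by simp
    have "integrable lborel (indicator {- e..e} :: real \<Rightarrow> real)"
      by (rule integrable_real_indicator) (simp_all add: emeasure_lborel_Icc_eq)
    then show "AE t in lborel. integrable lborel (\<lambda>s. g (t, s))"
      by (simp add: g_def)
  qed
  then have g: "integrable lborel g"
    by (simp add: lborel_prod)
  have C_int: "integrable lborel (indicator C :: pt \<Rightarrow> real)"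
    using C(1) by (intro integrable_real_indicator) (simp_all add: borel_compact emeasure_bounded_finite[OF compact_imp_bounded, simplified])
  show "integrable lborel K"
  proof (rule Bochner_Integration.integrable_bound)
    show "integrable lborel (\<lambda>z. g z + B * indicator C z)"
      by (intro Bochner_Integration.integrable_add integrable_mult_right g C_int)
    show "K \<in> borel_measurable lborel"
      using meas by simp
    have "norm (K z) \<le> norm (g z + B * indicator C z)" for z
    proof -
      have g_nonneg: "g z \<ge> 0"
        by (simp add: g_def h_def split: prod.split)
      consider "z \<notin> C" | "z \<in> C - ball 0 e" | "z \<in> C" "z \<in> ball 0 e"
        by blast
      then show ?thesis
      proof cases
        case 1
        then show ?thesis
          by (simp add: C)
      next
        case 2
        then show ?thesis
          using B(2)[OF 2] g_nonneg by simp
      next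
        case 3
        obtain t s where z: "z = (t, s)"
          by force
        have ts: "t \<le> e" "s \<in> {- e..e}"
          using 3(2) norm_fst_le[of t s] norm_snd_le[of s t] by (auto simp: z)
        have "\<bar>heat_kernel z\<bar> \<le> g z"
        proof (cases "t > 0")
          case True
          \<comment> \<open>The exponential is at most 1, and 4 * pi * t is at least t.\<close>
          have "exp (- s\<^sup>2 / (4 * t)) / sqrt (4 * pi * t) \<le> 1 / sqrt t"
            using True pi_gt3 by (intro frac_le) auto
          also have "1 / sqrt t = t powr (- 1 / 2)"
            using True by (simp add: powr_minus_divide powr_half_sqrt)
          finally show ?thesis
            using True ts by (simp add: heat_kernel_def g_def h_def z)
        next
          case False
          then show ?thesis
            using g_nonneg by (simp add: heat_kernel_def z)
        qed
        then show ?thesis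
          using 3 e(2) B(1) by simp
      qed
    qed
    then show "AE z in lborel. norm (K z) \<le> norm (g z + B * indicator C z)"
      by simp
  qed
qed


section \<open>Second spatial derivatives\<close>

text \<open>Smoothness of f is part of the relation because sums and multiples of derivatives are
  derivatives only for differentiable functions.\<close>

definition has_dxx :: "(pt \<Rightarrow> real) \<Rightarrow> (pt \<Rightarrow> real) \<Rightarrow> bool" where
  "has_dxx f g \<longleftrightarrow> smooth f \<and> pd 1 (pd 1 f) = g"

lemma has_dxx_zero: "has_dxx (\<lambda>z. 0) (\<lambda>z. 0)"
  by (simp add: has_dxx_def pd_const)

lemma has_dxx_add:
  "has_dxx f f' \<Longrightarrow> has_dxx g g' \<Longrightarrow> has_dxx (\<lambda>z. f z + g z) (\<lambda>z. f' z + g' z)"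
  by (auto simp: has_dxx_def smooth_add pd_add smooth_pd)

lemma has_dxx_cmult: "has_dxx f f' \<Longrightarrow> has_dxx (\<lambda>z. c * f z) (\<lambda>z. c * f' z)"
  by (auto simp: has_dxx_def smooth_cmult pd_cmult smooth_pd)

lemma has_dxx_diff:
  "has_dxx f f' \<Longrightarrow> has_dxx g g' \<Longrightarrow> has_dxx (\<lambda>z. f z - g z) (\<lambda>z. f' z - g' z)"
  using has_dxx_add[OF _ has_dxx_cmult[of g g' "- 1"]] by simp

lemma has_dxx_sum:
  "(\<And>s. s \<in> S \<Longrightarrow> has_dxx (f s) (f' s)) \<Longrightarrow> has_dxx (\<lambda>z. \<Sum>s\<in>S. f s z) (\<lambda>z. \<Sum>s\<in>S. f' s z)"
  by (induction S rule: infinite_finite_induct) (auto intro: has_dxx_zero has_dxx_add)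

text \<open>Two derivatives act on a normalised Taylor polynomial as an index shift h. Terms with
  index outside the range of h die, the one at \<open>h s\<close> becomes the one at s, and what
  remains is indexed by the preimage of S.\<close>

lemma has_dxx_sum_shift:
  assumes "finite S" "inj h"
    and zero: "\<And>s. s \<in> S \<Longrightarrow> s \<notin> range h \<Longrightarrow> has_dxx (f s) (\<lambda>z. 0)"
    and shift: "\<And>s. h s \<in> S \<Longrightarrow> has_dxx (f (h s)) (f' s)"
  shows "has_dxx (\<lambda>z. \<Sum>s\<in>S. f s z) (\<lambda>z. \<Sum>s\<in>h -` S. f' s z)"
proof -
  \<comment> \<open>The derivatives, still indexed by S and extended by 0 off the range of h.
    Differentiation is thus termwise, and reindexing comes afterwards.\<close>
  define F where "F = (\<lambda>s. if s \<in> range h then f' (inv h s) else (\<lambda>z. 0))"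
  have F_h: "F (h s) = f' s" for s
    using \<open>inj h\<close> by (simp add: F_def)
  have "has_dxx (\<lambda>z. \<Sum>s\<in>S. f s z) (\<lambda>z. \<Sum>s\<in>S. F s z)"
  proof (rule has_dxx_sum)
    show "has_dxx (f s) (F s)" if "s \<in> S" for s
      using that zero shift by (cases "s \<in> range h") (auto simp: F_h, simp add: F_def)
  qed
  also have "(\<lambda>z. \<Sum>s\<in>S. F s z) = (\<lambda>z. \<Sum>s\<in>h -` S. f' s z)"
  proof
    fix z
    have "(\<Sum>s\<in>S. F s z) = (\<Sum>s\<in>h ` (h -` S). F s z)"
      using \<open>finite S\<close> by (intro sum.mono_neutral_right) (auto simp: F_def)
    also have "\<dots> = (\<Sum>s\<in>h -` S. f' s z)"
      using \<open>inj h\<close> by (subst sum.reindex) (auto simp: F_h intro: inj_on_subset)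
    finally show "(\<Sum>s\<in>S. F s z) = (\<Sum>s\<in>h -` S. f' s z)" .
  qed
  finally show ?thesis .
qed

lemma shift_midx:
  fixes q :: midx
  shows "inj (\<lambda>q :: midx. q + (0, 2))" and "q \<notin> range (\<lambda>q. q + (0, 2)) \<Longrightarrow> snd q < 2"
proof -
  show "inj (\<lambda>q :: midx. q + (0, 2))"
    by (simp add: inj_def)
  assume q: "q \<notin> range (\<lambda>q. q + (0, 2))"
  show "snd q < 2"
  proof (rule ccontr)
    assume "\<not> snd q < 2"
    then have "q = (fst q, snd q - 2) + (0, 2)"
      by (simp add: prod_eq_iff)
    with q show False
      by blast
  qed
qed

text \<open>For \<open>snd k = 0\<close> the truncated subtraction is harmless, since the factor
  \<open>real (snd k)\<close> vanishes.\<close>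

lemma pd_1_pt_pow:
  "pd 1 (\<lambda>z. pt_pow (z - x) k) = (\<lambda>z. real (snd k) * pt_pow (z - x) (fst k, snd k - 1))"
  by (auto simp: pd_def pt_pow_def fun_eq_iff intro!: DERIV_imp_deriv derivative_eq_intros)

lemma has_dxx_pt_pow_zero:
  assumes "snd q < 2"
  shows "has_dxx (\<lambda>z. pt_pow (z - x) q / mfact q) (\<lambda>z. 0)"
proof -
  have "has_dxx (\<lambda>z. pt_pow (z - x) q) (\<lambda>z. 0)"
    using assms
    by (simp add: has_dxx_def smooth_pt_pow pd_1_pt_pow[unfolded One_nat_def] pd_cmult)
  from has_dxx_cmult[OF this, of "1 / mfact q"] show ?thesis
    by simp
qed

lemma has_dxx_pt_pow:
  "has_dxx (\<lambda>z. pt_pow (z - x) (q + (0, 2)) / mfact (q + (0, 2))) (\<lambda>z. pt_pow (z - x) q / mfact q)"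
proof -
  have "has_dxx (\<lambda>z. pt_pow (z - x) (q + (0, 2)))
      (\<lambda>z. real (snd q + 2) * (real (snd q + 1) * pt_pow (z - x) q))"
    by (simp add: has_dxx_def smooth_pt_pow pd_1_pt_pow[unfolded One_nat_def] pd_cmult)
  from has_dxx_cmult[OF this, of "1 / mfact (q + (0, 2))"]
  have "has_dxx (\<lambda>z. pt_pow (z - x) (q + (0, 2)) / mfact (q + (0, 2)))
      (\<lambda>z. (real (snd q + 2) * real (snd q + 1)) * pt_pow (z - x) q / mfact (q + (0, 2)))"
    by (simp only: mult.assoc times_divide_eq_left mult_1_left)
  moreover have "mfact (q + (0, 2)) = (real (snd q + 2) * real (snd q + 1)) * mfact q"
    by (simp add: mfact_def numeral_2_eq_2)
  ultimately show ?thesis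
    by (simp only: mult_divide_mult_cancel_left) simp
qed

section \<open>Families depending polynomially on a parameter\<close>

text \<open>Polynomials in \<epsilon> without a normal form: powers may repeat, so no coefficients
  have to be collected in products, and each closure property is a rule induction.\<close>

inductive poly_family :: "(real \<Rightarrow> pt \<Rightarrow> real) \<Rightarrow> bool" where
  monomial: "smooth c \<Longrightarrow> poly_family (\<lambda>\<epsilon> z. \<epsilon> ^ n * c z)"
| add: "poly_family F \<Longrightarrow> poly_family G \<Longrightarrow> poly_family (\<lambda>\<epsilon> z. F \<epsilon> z + G \<epsilon> z)"

lemma poly_family_smooth: "poly_family F \<Longrightarrow> smooth (F \<epsilon>)"
  by (induction rule: poly_family.induct) (simp_all add: smooth_cmult smooth_add)

lemma poly_family_const: "smooth f \<Longrightarrow> poly_family (\<lambda>\<epsilon>. f)"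
  using poly_family.monomial[of f 0] by simp

lemma poly_family_mult:
  assumes "poly_family F" "poly_family G"
  shows "poly_family (\<lambda>\<epsilon> z. F \<epsilon> z * G \<epsilon> z)"
  using assms
proof (induction arbitrary: G rule: poly_family.induct)
  case (monomial c n)
  from \<open>poly_family G\<close> show ?case
  proof (induction rule: poly_family.induct)
    case (monomial d m)
    have "poly_family (\<lambda>\<epsilon> z. \<epsilon> ^ (n + m) * (c z * d z))"
      by (intro poly_family.monomial smooth_mult monomial \<open>smooth c\<close>)
    then show ?case
      by (simp add: power_add mult_ac)
  next
    case (add F G)
    from poly_family.add[OF add.IH] show ?case
      by (simp add: distrib_left)
  qed
next
  case (add F1 F2)
  from poly_family.add[OF add.IH(1)[OF add.prems] add.IH(2)[OF add.prems]] show ?case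
    by (simp add: distrib_right)
qed

lemma poly_family_cmult: "poly_family F \<Longrightarrow> poly_family (\<lambda>\<epsilon> z. c * F \<epsilon> z)"
  by (rule poly_family_mult[OF poly_family_const[OF smooth_const]])

lemma poly_family_diff:
  "poly_family F \<Longrightarrow> poly_family G \<Longrightarrow> poly_family (\<lambda>\<epsilon> z. F \<epsilon> z - G \<epsilon> z)"
  using poly_family.add[OF _ poly_family_cmult[of G "- 1"]] by simp

lemma poly_family_sum:
  "(\<And>s. s \<in> S \<Longrightarrow> poly_family (F s)) \<Longrightarrow> poly_family (\<lambda>\<epsilon> z. \<Sum>s\<in>S. F s \<epsilon> z)"
  by (induction S rule: infinite_finite_induct)
    (auto intro: poly_family.add poly_family_const[OF smooth_const])

lemma poly_family_power: "poly_family F \<Longrightarrow> poly_family (\<lambda>\<epsilon> z. F \<epsilon> z ^ n)"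
  by (induction n) (auto intro: poly_family_mult poly_family_const[OF smooth_const])

lemma poly_family_prod_mset:
  "(\<And>s. s \<in># M \<Longrightarrow> poly_family (F s)) \<Longrightarrow> poly_family (\<lambda>\<epsilon> z. \<Prod>s\<in>#M. F s \<epsilon> z)"
  by (induction M) (auto intro: poly_family_mult poly_family_const[OF smooth_const])

lemma (in kernel) poly_family_conv: "poly_family F \<Longrightarrow> poly_family (\<lambda>\<epsilon>. conv K a (F \<epsilon>))"
proof (induction rule: poly_family.induct)
  case (monomial c n)
  then have "conv K a (\<lambda>z. \<epsilon> ^ n * c z) = (\<lambda>y. \<epsilon> ^ n * conv K a c y)" for \<epsilon>
    using conv_cmult by blast
  with monomial show ?case
    by (simp add: poly_family.monomial smooth_conv)
next
  case (add F G)
  then have "conv K a (\<lambda>z. F \<epsilon> z + G \<epsilon> z) = (\<lambda>y. conv K a (F \<epsilon>) y + conv K a (G \<epsilon>) y)" for \<epsilon>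
    using conv_add poly_family_smooth by blast
  with add show ?case
    by (simp add: poly_family.add)
qed

text \<open>Needed for the Taylor coefficients in \<open>hat_Pi\<close>: they are convolutions
  evaluated at the base point, which depend on \<epsilon> but not on z.\<close>

lemma poly_family_at: "poly_family F \<Longrightarrow> poly_family (\<lambda>\<epsilon> z. F \<epsilon> x)"
proof (induction rule: poly_family.induct)
  case (monomial c n)
  show ?case
    by (rule poly_family.monomial) simp
next
  case (add F G)
  then show ?case
    by (intro poly_family.add)
qed

text \<open>The coefficient of \<open>\<epsilon>\<close> is a smooth function, and it is the derivative at \<open>\<epsilon> = 0\<close>.\<close>

lemma has_dxx_deriv_poly_family:
  assumes "poly_family F" and "\<And>\<epsilon>. has_dxx (F \<epsilon>) (G \<epsilon>)"
  shows "has_dxx (\<lambda>z. deriv (\<lambda>\<epsilon>. F \<epsilon> z) 0) (\<lambda>z. deriv (\<lambda>\<epsilon>. G \<epsilon> z) 0)"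
proof -
  \<comment> \<open>The second derivative is taken of F itself, without mention of G, so that the
    claim can be proved by induction on F.\<close>
  have "\<exists>c d. has_dxx c d \<and> (\<forall>z. ((\<lambda>\<epsilon>. F \<epsilon> z) has_real_derivative c z) (at 0))
      \<and> (\<forall>z. ((\<lambda>\<epsilon>. pd 1 (pd 1 (F \<epsilon>)) z) has_real_derivative d z) (at 0))"
    using assms(1)
  proof (induction rule: poly_family.induct)
    case (monomial c n)
    \<comment> \<open>The factor is 1 for n = 1 and 0 for every other n; for n = 0 the power is 1
      but is multiplied by 0.\<close>
    let ?D = "\<lambda>c z. real n * 0 ^ (n - 1) * c z"
    have D: "((\<lambda>\<epsilon>. \<epsilon> ^ n * c z) has_real_derivative ?D c z) (at 0)" for c :: "pt \<Rightarrow> real" and z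
      by (auto intro!: derivative_eq_intros)
    have dxx: "pd 1 (pd 1 (\<lambda>z. \<epsilon> ^ n * c z)) = (\<lambda>z. \<epsilon> ^ n * pd 1 (pd 1 c) z)" for \<epsilon>
      using monomial by (simp only: pd_cmult smooth_pd)
    have "has_dxx (?D c) (?D (pd 1 (pd 1 c)))"
      using monomial by (intro has_dxx_cmult) (simp add: has_dxx_def)
    then show ?case
      using D[of c] D[of "pd 1 (pd 1 c)"] unfolding dxx by meson
  next
    case (add F G)
    then obtain c d c' d' where "has_dxx c d" "has_dxx c' d'"
      and D: "((\<lambda>\<epsilon>. F \<epsilon> z) has_real_derivative c z) (at 0)"
        "((\<lambda>\<epsilon>. pd 1 (pd 1 (F \<epsilon>)) z) has_real_derivative d z) (at 0)"
        "((\<lambda>\<epsilon>. G \<epsilon> z) has_real_derivative c' z) (at 0)"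
        "((\<lambda>\<epsilon>. pd 1 (pd 1 (G \<epsilon>)) z) has_real_derivative d' z) (at 0)" for z
      by meson
    have dxx: "pd 1 (pd 1 (\<lambda>z. F \<epsilon> z + G \<epsilon> z)) = (\<lambda>z. pd 1 (pd 1 (F \<epsilon>)) z + pd 1 (pd 1 (G \<epsilon>)) z)" for \<epsilon>
      using add by (simp only: pd_add smooth_pd poly_family_smooth)
    have "has_dxx (\<lambda>z. c z + c' z) (\<lambda>z. d z + d' z)"
      by (rule has_dxx_add) fact+
    then show ?case
      using DERIV_add[OF D(1) D(3)] DERIV_add[OF D(2) D(4)] unfolding dxx by meson
  qed
  then obtain c d where cd: "has_dxx c d"
    and D: "\<And>z. ((\<lambda>\<epsilon>. F \<epsilon> z) has_real_derivative c z) (at 0)"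
      "\<And>z. ((\<lambda>\<epsilon>. pd 1 (pd 1 (F \<epsilon>)) z) has_real_derivative d z) (at 0)"
    by meson
  have "pd 1 (pd 1 (F \<epsilon>)) = G \<epsilon>" for \<epsilon>
    using assms(2) by (simp add: has_dxx_def)
  with D(2) have "deriv (\<lambda>\<epsilon>. G \<epsilon> z) 0 = d z" for z
    by (simp add: DERIV_imp_deriv)
  with cd DERIV_imp_deriv[OF D(1)] show ?thesis
    by simp
qed


section \<open>The model on planted trees\<close>

text \<open>The local function P of \<open>hat_Pi\<close>, given a name. The test on noises is kept
  so that \<open>hat_Pi_Node\<close> holds for every R.\<close>

definition Pi_basis :: "real \<Rightarrow> ((dtree \<Rightarrow>\<^sub>0 real) \<Rightarrow> (dtree \<Rightarrow>\<^sub>0 real)) \<Rightarrow> (pt \<Rightarrow> real) \<Rightarrow> (pt \<Rightarrow> real) \<Rightarrow>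
    (pt \<Rightarrow> real) \<Rightarrow> nat \<Rightarrow> pt \<Rightarrow> dtree \<Rightarrow> pt \<Rightarrow> real" where
  "Pi_basis \<alpha> R K \<xi> \<delta>\<xi> i x t z = (\<Sum>s\<in>Poly_Mapping.keys (R (bas t)).
     if s = t \<or> noises s < noises t
     then Poly_Mapping.lookup (R (bas t)) s * hat_Pi \<alpha> R K \<xi> \<delta>\<xi> i x s z else 0)"

lemma hat_Pi_Node:
  "hat_Pi \<alpha> R K \<xi> \<delta>\<xi> i x (Node k l m M) y =
     pt_pow (y - x) k * \<xi> y ^ l * \<delta>\<xi> y ^ m
     * (\<Prod>p\<in>#M. conv K (fst p) (Pi_basis \<alpha> R K \<xi> \<delta>\<xi> i x (snd p)) y
          - (\<Sum>q\<in>{q. real (wt q) < deg \<alpha> i (planted (fst p) (snd p))}.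
               pt_pow (y - x) q / mfact q * conv K (fst p + q) (Pi_basis \<alpha> R K \<xi> \<delta>\<xi> i x (snd p)) x))"
  unfolding hat_Pi.simps[of \<alpha> R K \<xi> \<delta>\<xi> i x] Pi_basis_def[abs_def] Let_def case_prod_unfold ..

lemma hat_Pi_planted:
  "hat_Pi \<alpha> R K \<xi> \<delta>\<xi> i x (planted a t) =
     (\<lambda>y. conv K a (Pi_basis \<alpha> R K \<xi> \<delta>\<xi> i x t) y
       - (\<Sum>q\<in>{q. real (wt q) < deg \<alpha> i (planted a t)}.
            conv K (a + q) (Pi_basis \<alpha> R K \<xi> \<delta>\<xi> i x t) x * (pt_pow (y - x) q / mfact q)))"
  unfolding planted_def by (rule ext, subst hat_Pi_Node) (simp add: pt_pow_def planted_def mult.commute)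

lemma hat_Pi_X_pow: "hat_Pi \<alpha> R K \<xi> \<delta>\<xi> i x (X_pow k) = (\<lambda>y. pt_pow (y - x) k)"
  unfolding X_pow_def by (rule ext, subst hat_Pi_Node) simp

text \<open>Induction along the recursion of \<open>hat_Pi\<close>, which at a node calls each child
  and all trees with fewer noises than that child. The latter may be larger trees, so the order is
  lexicographic in noises and size.\<close>

lemma dtree_noises_induct:
  assumes "\<And>k l m M. (\<And>a t s. (a, t) \<in># M \<Longrightarrow> s = t \<or> noises s < noises t \<Longrightarrow> P s) \<Longrightarrow> P (Node k l m M)"
  shows "P t"
proof -
  let ?r = "measures [noises, size]"
  have "wf ?r"
    by simp
  then show ?thesis
  proof (induction t rule: wf_induct_rule)
    case (less t)
    obtain k l m M where t: "t = Node k l m M"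
      by (cases t)
    show ?case
      unfolding t
    proof (rule assms)
      fix a u s
      assume u: "(a, u) \<in># M" and "s = u \<or> noises s < noises u"
      then have "(s, t) \<in> ?r"
        using noises_child[OF u, of k l m] size_child[OF u, of k l m]
        by (auto simp del: noises.simps dtree.size simp: t)
      then show "P s"
        by (rule less)
    qed
  qed
qed

lemma finite_wt_less: "finite {q. real (wt q) < c}"
proof (rule finite_subset)
  show "{q. real (wt q) < c} \<subseteq> {..nat \<lceil>c\<rceil>} \<times> {..nat \<lceil>c\<rceil>}"
    by (auto simp: wt_def) linarith+
qed simp

lemma deg_planted: "deg \<alpha> i (planted a t) = deg \<alpha> i t + 2 - real (wt a)"
  by (simp add: planted_def wt_def zero_prod_def)

lemma wt_add: "wt (p + q) = wt p + wt q"
  by (simp add: wt_def)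

section \<open>Smoothness and second derivatives of the model\<close>

context kernel
begin

text \<open>Every operation in the recursion preserves polynomial families, and the perturbed noise
  is one of degree at most 1. The interpretation of the second noise stays fixed, as in
  \<open>delta_hat_Pi\<close>.\<close>

lemma poly_family_hat_Pi:
  assumes "smooth \<xi>" "smooth \<delta>\<xi>"
  shows "poly_family (\<lambda>\<epsilon>. hat_Pi \<alpha> R K (\<lambda>z. \<xi> z + \<epsilon> * \<delta>\<xi> z) \<delta>\<xi> i x t)"
proof (induction t rule: dtree_noises_induct)
  case (1 k l m M)
  let ?P = "\<lambda>\<epsilon>. Pi_basis \<alpha> R K (\<lambda>z. \<xi> z + \<epsilon> * \<delta>\<xi> z) \<delta>\<xi> i x"
  have P: "poly_family (\<lambda>\<epsilon>. ?P \<epsilon> (snd p))" if "p \<in># M" for p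
    unfolding Pi_basis_def[abs_def]
  proof (intro poly_family_sum)
    fix s
    show "poly_family (\<lambda>\<epsilon> z. if s = snd p \<or> noises s < noises (snd p)
       then Poly_Mapping.lookup (R (bas (snd p))) s * hat_Pi \<alpha> R K (\<lambda>z. \<xi> z + \<epsilon> * \<delta>\<xi> z) \<delta>\<xi> i x s z else 0)"
      using 1[of "fst p" "snd p" s] that
      by (cases "s = snd p \<or> noises s < noises (snd p)")
        (auto intro: poly_family_cmult poly_family_const[OF smooth_const])
  qed
  have noise: "poly_family (\<lambda>\<epsilon> z. \<xi> z + \<epsilon> * \<delta>\<xi> z)"
    using poly_family.add[OF poly_family_const[OF assms(1)] poly_family.monomial[OF assms(2), of 1]]
    by simp
  have "smooth (\<lambda>z. pt_pow (z - x) q / mfact q)" for q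
    using smooth_cmult[OF smooth_pt_pow, of "1 / mfact q"] by simp
  then show ?case
    unfolding hat_Pi_Node[abs_def]
    by (intro poly_family_mult poly_family_prod_mset poly_family_diff poly_family_sum poly_family_power
        poly_family_conv poly_family_at[OF poly_family_conv] P noise poly_family_const[OF assms(2)] poly_family_const[OF smooth_pt_pow]
        poly_family_const)
qed

lemma smooth_hat_Pi:
  assumes "smooth \<xi>" "smooth \<delta>\<xi>"
  shows "smooth (hat_Pi \<alpha> R K \<xi> \<delta>\<xi> i x t)"
  using poly_family_smooth[OF poly_family_hat_Pi[OF assms], where \<epsilon> = 0] by simp

lemma smooth_Pi_basis:
  assumes "smooth \<xi>" "smooth \<delta>\<xi>"
  shows "smooth (Pi_basis \<alpha> R K \<xi> \<delta>\<xi> i x t)"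
proof -
  have "smooth (\<lambda>z. if b then f z else 0)" if "smooth f" for b and f :: "pt \<Rightarrow> real"
    using that by (cases b) simp_all
  then have "poly_family (\<lambda>\<epsilon>. Pi_basis \<alpha> R K \<xi> \<delta>\<xi> i x t)"
    unfolding Pi_basis_def[abs_def]
    by (intro poly_family_sum poly_family_const) (simp add: smooth_cmult smooth_hat_Pi[OF assms])
  then show ?thesis
    by (rule poly_family_smooth)
qed

lemma has_dxx_hat_Pi_planted:
  assumes "smooth \<xi>" "smooth \<delta>\<xi>"
  shows "has_dxx (hat_Pi \<alpha> R K \<xi> \<delta>\<xi> i x (planted 0 t)) (hat_Pi \<alpha> R K \<xi> \<delta>\<xi> i x (planted (0, 2) t))"
proof -
  let ?P = "Pi_basis \<alpha> R K \<xi> \<delta>\<xi> i x t"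
  let ?S = "{q. real (wt q) < deg \<alpha> i (planted 0 t)}"
  let ?up = "\<lambda>q :: midx. q + (0, 2)"
  have P: "smooth ?P"
    by (rule smooth_Pi_basis[OF assms])
  have "pd 1 (pd 1 (conv K 0 ?P)) = conv K 0 (D_multi (0, 2) ?P)"
    using P by (simp add: pd_conv_0 smooth_pd D_multi_def numeral_2_eq_2)
  then have 1: "has_dxx (conv K 0 ?P) (conv K (0, 2) ?P)"
    using P by (simp add: has_dxx_def smooth_conv conv_eq_conv_0[of "(0, 2)"])
  have 2: "has_dxx (\<lambda>y. \<Sum>q\<in>?S. conv K (0 + q) ?P x * (pt_pow (y - x) q / mfact q))
      (\<lambda>y. \<Sum>q\<in>?up -` ?S. conv K ((0, 2) + q) ?P x * (pt_pow (y - x) q / mfact q))"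
  proof (rule has_dxx_sum_shift)
    show "finite ?S"
      by (rule finite_wt_less)
    show "inj ?up"
      by (rule shift_midx)
    fix q :: midx
    assume "q \<notin> range ?up"
    then have "snd q < 2"
      by (rule shift_midx)
    from has_dxx_cmult[OF has_dxx_pt_pow_zero[OF this]]
    show "has_dxx (\<lambda>y. conv K (0 + q) ?P x * (pt_pow (y - x) q / mfact q)) (\<lambda>z. 0)"
      by simp
  next
    fix q :: midx
    from has_dxx_cmult[OF has_dxx_pt_pow, of "conv K (0 + (q + (0, 2))) ?P x"]
    show "has_dxx (\<lambda>y. conv K (0 + (q + (0, 2))) ?P x * (pt_pow (y - x) (q + (0, 2)) / mfact (q + (0, 2))))
        (\<lambda>y. conv K ((0, 2) + q) ?P x * (pt_pow (y - x) q / mfact q))"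
      by (simp add: add.commute)
  qed
  \<comment> \<open>|q| + 2 lies below the degree of I(t) exactly when |q| lies below the degree of
    I_2(t), because (0, 2) has weight 2.\<close>
  have "?up -` ?S = {q. real (wt q) < deg \<alpha> i (planted (0, 2) t)}"
    by (auto simp: deg_planted wt_add wt_def)
  with has_dxx_diff[OF 1 2] show ?thesis
    by (simp only: hat_Pi_planted)
qed

end

section \<open>Linear extensions and tensor products\<close>

lemma lookup_scaleR: "Poly_Mapping.lookup (c *\<^sub>R p) k = c * Poly_Mapping.lookup p k"
  for p :: "'a \<Rightarrow>\<^sub>0 real"
  by (simp add: scaleR_poly_mapping_def map.rep_eq when_def)

lemma lin_ext_superset:
  assumes "finite S" "Poly_Mapping.keys p \<subseteq> S"
  shows "lin_ext f p = (\<Sum>t\<in>S. Poly_Mapping.lookup p t *\<^sub>R f t)"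
  unfolding lin_ext_def using assms
  by (intro sum.mono_neutral_left) (auto simp: in_keys_iff)

lemma linear_lin_ext: "linear (lin_ext f)"
proof (rule linearI)
  fix p q :: "'a \<Rightarrow>\<^sub>0 real"
  let ?S = "Poly_Mapping.keys p \<union> Poly_Mapping.keys q"
  have "Poly_Mapping.keys (p + q) \<subseteq> ?S"
    by (rule keys_add)
  then show "lin_ext f (p + q) = lin_ext f p + lin_ext f q"
    by (simp add: lin_ext_superset[of ?S] lookup_add scaleR_add_left sum.distrib)
next
  fix c and p :: "'a \<Rightarrow>\<^sub>0 real"
  have "Poly_Mapping.keys (c *\<^sub>R p) \<subseteq> Poly_Mapping.keys p"
    by (auto simp: in_keys_iff lookup_scaleR)
  then show "lin_ext f (c *\<^sub>R p) = c *\<^sub>R lin_ext f p"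
    by (simp add: lin_ext_superset[of "Poly_Mapping.keys p"] lookup_scaleR scaleR_sum_right)
qed

lemmas lin_ext_add = linear_add[OF linear_lin_ext]
  and lin_ext_diff = linear_diff[OF linear_lin_ext]
  and lin_ext_scaleR = linear_scale[OF linear_lin_ext]
  and lin_ext_sum = linear_sum[OF linear_lin_ext]
  and lin_ext_0 = linear_0[OF linear_lin_ext]

lemma lin_ext_bas [simp]: "lin_ext f (bas t) = f t"
  by (simp add: lin_ext_def)

lemma linear_lin_ext_distrib: "linear L \<Longrightarrow> L (lin_ext f p) = lin_ext (\<lambda>t. L (f t)) p"
  by (simp add: lin_ext_def linear_sum linear_scale)

lemma bas_mult: "bas a * bas b = (bas (a + b) :: 'a::comm_monoid_add \<Rightarrow>\<^sub>0 real)"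
  by (simp add: mult_single)

lemma lin_ext_tensor: "lin_ext F (p \<otimes> q) = lin_ext (\<lambda>a. lin_ext (\<lambda>b. F (a, b)) q) p"
  by (simp add: tensor_def linear_lin_ext_distrib[OF linear_lin_ext])

lemma lin_ext_tensor_map:
  "lin_ext F (tensor_map f g u) = lin_ext (\<lambda>(a, b). lin_ext F (f a \<otimes> g b)) u"
  by (simp add: tensor_map_def linear_lin_ext_distrib[OF linear_lin_ext] case_prod_unfold)

lemma tensor_bas: "bas a \<otimes> bas b = bas (a, b)"
  by (simp add: tensor_def)

lemma tensor_0_right: "p \<otimes> 0 = 0"
  by (simp add: tensor_def lin_ext_def)

lemma lin_ext_mult_right: "lin_ext (\<lambda>b. h b *\<^sub>R w) q = lin_ext h q *\<^sub>R w"
  by (simp add: lin_ext_def scaleR_sum_left)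

lemma tensor_one: "1 \<otimes> 1 = 1"
  using tensor_bas[of 0 0] by (simp add: zero_prod_def[symmetric])

lemma lin_ext_id: "lin_ext bas p = p"
  by (rule poly_mapping_eqI)
    (simp add: lin_ext_def lookup_sum lookup_scaleR lookup_single when_def if_distrib in_keys_iff
      cong: if_cong)

text \<open>A scalar is multiplication by an element supported at the unit of the monoid, so both
  rules are associativity and commutativity of the ring.\<close>

lemma scaleR_mult_left: "(c *\<^sub>R p) * q = c *\<^sub>R (p * q)"
  and scaleR_mult_right: "p * (c *\<^sub>R q) = c *\<^sub>R (p * q)"
  for p q :: "'a::comm_monoid_add \<Rightarrow>\<^sub>0 real"
proof -
  have "c *\<^sub>R r = Poly_Mapping.single 0 c * r" for r :: "'a \<Rightarrow>\<^sub>0 real"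
    unfolding scaleR_poly_mapping_def real_scaleR_def[abs_def] by (rule mult_map_scale_conv_mult)
  then show "(c *\<^sub>R p) * q = c *\<^sub>R (p * q)" "p * (c *\<^sub>R q) = c *\<^sub>R (p * q)"
    by (simp_all add: ac_simps)
qed


section \<open>The coactions on planted trees and polynomials\<close>

text \<open>With this normalisation the second spatial derivative is a pure index shift, without
  numerical factors.\<close>

definition X_normed :: "midx \<Rightarrow> (dtree \<Rightarrow>\<^sub>0 real)" where
  "X_normed p = (1 / mfact p) *\<^sub>R bas (X_pow p)"

lemma Node_0: "Node 0 0 0 {#} = 0"
  by (simp add: zero_dtree_def)

lemma Delta_planted:
  "Delta \<alpha> i (planted a t) = tensor_map (\<lambda>s. bas (planted a s)) bas (Delta \<alpha> i t)
     + (\<Sum>p\<in>{p. real (wt (fst p + snd p)) < deg \<alpha> i (planted a t)}.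
          X_normed (fst p)
            \<otimes> ((1 / mfact (snd p)) *\<^sub>R (Xp (snd p) * Ip \<alpha> i (a + fst p + snd p) t)))"
  by (subst planted_def, subst Delta.simps) (simp add: X_normed_def case_prod_unfold)

lemma hat_Delta0_planted:
  "hat_Delta0 \<alpha> (planted a t) = tensor_map (\<lambda>s. bas (planted a s)) bas (hat_Delta0 \<alpha> t)
     - Sum_any (\<lambda>p. if deg \<alpha> 1 (planted a t) \<le> real (wt p)
         then X_normed p \<otimes> lin_ext (\<lambda>(s, c). Ip \<alpha> 0 (a + p) s * bas c) (hat_Delta0 \<alpha> t)
         else 0)"
  unfolding X_normed_def
  by (subst planted_def, subst hat_Delta0.simps) (simp add: Node_0 tensor_one)

lemma D_Xi_planted: "D_Xi (planted a t) = plant a (D_Xi t)"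
  by (simp add: planted_def Node_0)

lemma linear_Q0: "linear Q0"
  unfolding Q0_def by (rule linear_lin_ext)

lemma Q0_X_normed: "Q0 (X_normed q) = X_normed q"
  by (simp add: Q0_def X_normed_def lin_ext_scaleR X_pow_def)

text \<open>Hence \<open>Q0\<close> cannot distinguish \<open>planted 0 t\<close> from
  \<open>planted (0, 2) t\<close> and respects the exchange of the two.\<close>

lemma noises1_planted: "noises1 (planted a t) = noises1 t"
  by (simp add: planted_def)

text \<open>For g = \<open>gamma_char\<close> and applied to \<open>Delta\<close> this is
  \<open>Gamma\<close>; g is left arbitrary.\<close>

definition Id_otimes :: "(pbasis \<Rightarrow> real) \<Rightarrow> (dtree \<times> pbasis \<Rightarrow>\<^sub>0 real) \<Rightarrow> (dtree \<Rightarrow>\<^sub>0 real)" where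
  "Id_otimes g = lin_ext (\<lambda>(s, b). g b *\<^sub>R bas s)"

lemma Id_otimes_tensor: "Id_otimes g (p \<otimes> q) = lin_ext g q *\<^sub>R p"
  by (simp add: Id_otimes_def lin_ext_tensor lin_ext_mult_right lin_ext_id
      linear_lin_ext_distrib[OF linear_scale_self, symmetric])

lemma X_pow_add: "X_pow p + X_pow q = X_pow (p + q)"
  by (simp add: X_pow_def)

text \<open>Binomial theorem in the tensor algebra; dividing by n! turns the binomial coefficient
  into the two factorials that normalise the monomials.\<close>

lemma coaction_X_power:
  fixes e :: midx
  shows "(1 / fact n) *\<^sub>R (bas (X_pow e) \<otimes> 1 + 1 \<otimes> Xp e) ^ n =
    (\<Sum>k\<le>n. (1 / (fact k * fact (n - k))) *\<^sub>R
       bas (X_pow (k * fst e, k * snd e), ((n - k) * fst e, (n - k) * snd e), {#}))"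
proof -
  have 1: "bas (X_pow e) \<otimes> 1 = bas (X_pow e, 0)" "1 \<otimes> Xp e = bas (0, e, {#})"
    using tensor_bas[of "X_pow e" 0] tensor_bas[of 0 "(e, {#})"] by (simp_all add: Xp_def)
  have A: "bas (X_pow e, 0 :: pbasis) ^ k = bas (X_pow (k * fst e, k * snd e), 0)" for k
    by (induction k)
      (simp_all add: bas_mult X_pow_add plus_prod_def zero_prod_def X_pow_def Node_0
        flip: zero_prod_def single_one)
  have B: "bas (0 :: dtree, e, {#}) ^ k = bas (0, (k * fst e, k * snd e), {#})" for k
    by (induction k)
      (simp_all add: bas_mult plus_prod_def zero_prod_def flip: single_one)
  have "of_nat c * r = real c *\<^sub>R r" for c and r :: "dtree \<times> pbasis \<Rightarrow>\<^sub>0 real"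
    by (induction c) (simp_all add: distrib_right scaleR_add_left)
  then have "(1 / fact n) *\<^sub>R (bas (X_pow e) \<otimes> 1 + 1 \<otimes> Xp e) ^ n =
    (\<Sum>k\<le>n. (real (n choose k) / fact n) *\<^sub>R
       bas (X_pow (k * fst e, k * snd e), ((n - k) * fst e, (n - k) * snd e), {#}))"
    unfolding 1 binomial_ring A B
    by (simp add: bas_mult scaleR_sum_right scaleR_mult_left)
  also have "\<dots> = (\<Sum>k\<le>n. (1 / (fact k * fact (n - k))) *\<^sub>R
       bas (X_pow (k * fst e, k * snd e), ((n - k) * fst e, (n - k) * snd e), {#}))"
    by (intro sum.cong refl) (simp add: binomial_fact)
  finally show ?thesis .
qed

text \<open>The point is the form of the coefficient: it depends on p - q only.\<close>

lemma Id_otimes_Delta_X_pow: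
  "(1 / mfact p) *\<^sub>R Id_otimes g (Delta \<alpha> i (X_pow p)) =
    (\<Sum>q\<in>{..fst p} \<times> {..snd p}.
       (g (p - q, {#}) / mfact (p - q)) *\<^sub>R X_normed q)"
proof -
  have "(1 / mfact p) *\<^sub>R Delta \<alpha> i (X_pow p) =
      ((1 / fact (fst p)) *\<^sub>R (bas (X_pow (1, 0)) \<otimes> 1 + 1 \<otimes> Xp (1, 0)) ^ fst p)
      * ((1 / fact (snd p)) *\<^sub>R (bas (X_pow (0, 1)) \<otimes> 1 + 1 \<otimes> Xp (0, 1)) ^ snd p)"
    by (subst X_pow_def, subst Delta.simps) (simp add: mfact_def scaleR_mult_left scaleR_mult_right)
  also have "\<dots> = (\<Sum>k\<le>fst p. \<Sum>l\<le>snd p.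
      (1 / (fact k * fact (fst p - k) * (fact l * fact (snd p - l)))) *\<^sub>R
        bas (X_pow (k, l), (fst p - k, snd p - l), {#}))"
    unfolding coaction_X_power
    by (simp add: sum_product scaleR_mult_left scaleR_mult_right bas_mult X_pow_add)
      (simp add: mult.commute)
  also have "\<dots> = (\<Sum>q\<in>{..fst p} \<times> {..snd p}.
      (1 / (mfact q * mfact (p - q))) *\<^sub>R bas (X_pow q, p - q, {#}))"
    by (simp add: sum.cartesian_product mfact_def case_prod_unfold minus_prod_def mult_ac)
  finally have "(1 / mfact p) *\<^sub>R Delta \<alpha> i (X_pow p) = \<dots>" .
  then have "Id_otimes g ((1 / mfact p) *\<^sub>R Delta \<alpha> i (X_pow p)) =
      (\<Sum>q\<in>{..fst p} \<times> {..snd p}. (g (p - q, {#}) / mfact (p - q)) *\<^sub>R X_normed q)"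
    by (simp add: Id_otimes_def lin_ext_sum lin_ext_scaleR X_normed_def mult.commute)
  then show ?thesis
    by (simp add: Id_otimes_def lin_ext_scaleR)
qed

lemma Id_otimes_Delta_planted:
  "Id_otimes g (Delta \<alpha> i (planted a t)) = lin_ext (\<lambda>(s, b). g b *\<^sub>R bas (planted a s)) (Delta \<alpha> i t)
     + (\<Sum>p\<in>{p. real (wt (fst p + snd p)) < deg \<alpha> i (planted a t)}.
          lin_ext g ((1 / mfact (snd p)) *\<^sub>R (Xp (snd p) * Ip \<alpha> i (a + fst p + snd p) t))
            *\<^sub>R X_normed (fst p))"
  unfolding Delta_planted Id_otimes_def lin_ext_add lin_ext_sum
  unfolding Id_otimes_def[symmetric] Id_otimes_tensor
  by (simp add: Id_otimes_def lin_ext_tensor_map tensor_bas case_prod_unfold)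


section \<open>The second derivative of a modelled tree\<close>

text \<open>
  On the trees that occur in \<open>d\<Gamma> \<I>(\<tau>)\<close> the second spatial derivative is an operation on trees: it sends
  \<open>\<I>(t)\<close> to \<open>\<I>\<^sub>2(t)\<close> and \<open>X\<^sup>q/q!\<close> to \<open>X\<^sup>q\<^sup>-\<^sup>2/(q-2)!\<close>. It is kept as a relation, since it need not be defined on
  other trees.
\<close>

locale dxx_model =
  fixes W :: "dtree \<Rightarrow> pt \<Rightarrow> real" and x :: pt
  assumes W_planted: "has_dxx (W (planted 0 t)) (W (planted (0, 2) t))"
    and W_X_pow: "W (X_pow k) = (\<lambda>z. pt_pow (z - x) k)"
begin

definition rel :: "(dtree \<Rightarrow>\<^sub>0 real) \<Rightarrow> (dtree \<Rightarrow>\<^sub>0 real) \<Rightarrow> bool" where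
  "rel p q \<longleftrightarrow> has_dxx (\<lambda>z. lin_ext (\<lambda>t. W t z) p) (\<lambda>z. lin_ext (\<lambda>t. W t z) q)"

lemma rel_0: "rel 0 0"
  by (simp add: rel_def lin_ext_0 has_dxx_zero)

lemma rel_add: "rel p q \<Longrightarrow> rel p' q' \<Longrightarrow> rel (p + p') (q + q')"
  by (simp add: rel_def lin_ext_add has_dxx_add)

lemma rel_diff: "rel p q \<Longrightarrow> rel p' q' \<Longrightarrow> rel (p - p') (q - q')"
  by (simp add: rel_def lin_ext_diff has_dxx_diff)

lemma rel_scaleR: "rel p q \<Longrightarrow> rel (c *\<^sub>R p) (c *\<^sub>R q)"
  by (simp add: rel_def lin_ext_scaleR has_dxx_cmult)

lemma rel_scaleR_0: "rel p 0 \<Longrightarrow> rel (c *\<^sub>R p) 0"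
  using rel_scaleR[of p 0 c] by simp

lemma rel_lin_ext: "(\<And>t. rel (u t) (v t)) \<Longrightarrow> rel (lin_ext u p) (lin_ext v p)"
  unfolding lin_ext_def[of u] lin_ext_def[of v] rel_def lin_ext_sum lin_ext_scaleR real_scaleR_def
  by (intro has_dxx_sum has_dxx_cmult)

lemma rel_sum_shift:
  assumes "finite S" "inj h"
    and "\<And>s. s \<in> S \<Longrightarrow> s \<notin> range h \<Longrightarrow> rel (u s) 0"
    and "\<And>s. h s \<in> S \<Longrightarrow> rel (u (h s)) (v s)"
  shows "rel (\<Sum>s\<in>S. u s) (\<Sum>s\<in>h -` S. v s)"
  using has_dxx_sum_shift[OF assms(1,2), of "\<lambda>s z. lin_ext (\<lambda>t. W t z) (u s)" "\<lambda>s z. lin_ext (\<lambda>t. W t z) (v s)"]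
    assms(3,4)
  by (simp add: rel_def lin_ext_sum lin_ext_0)

lemma rel_X_normed_0: "snd q < 2 \<Longrightarrow> rel (X_normed q) 0"
  using has_dxx_pt_pow_zero by (simp add: rel_def X_normed_def lin_ext_scaleR W_X_pow lin_ext_0)

lemma rel_X_normed: "rel (X_normed (q + (0, 2))) (X_normed q)"
  using has_dxx_pt_pow by (simp add: rel_def X_normed_def lin_ext_scaleR W_X_pow)

text \<open>The planted part is exchanged term by term. In the polynomial part the coefficient of
  X^p involves a only through a + p, so moving (0, 2) from the polynomial index to a leaves it
  unchanged.\<close>

lemma rel_Id_otimes_planted:
  "rel (Q0 (Id_otimes g (Delta \<alpha> i (planted 0 t)))) (Q0 (Id_otimes g (Delta \<alpha> i (planted (0, 2) t))))"
proof -
  let ?S = "\<lambda>a. {p :: midx \<times> midx. real (wt (fst p + snd p)) < deg \<alpha> i (planted a t)}"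
  let ?c = "\<lambda>a p. lin_ext g ((1 / mfact (snd p)) *\<^sub>R (Xp (snd p) * Ip \<alpha> i (a + fst p + snd p) t))"
  \<comment> \<open>Only the first index shifts: it is the exponent of the monomial in the tree
    factor, while the second one sits inside the coefficient.\<close>
  let ?up = "\<lambda>p :: midx \<times> midx. (fst p + (0, 2), snd p)"
  have eq: "Q0 (Id_otimes g (Delta \<alpha> i (planted a t))) =
      lin_ext (\<lambda>(s, b). g b *\<^sub>R (if noises1 s = 0 then bas (planted a s) else 0)) (Delta \<alpha> i t)
      + (\<Sum>p\<in>?S a. ?c a p *\<^sub>R X_normed (fst p))" for a
    unfolding Id_otimes_Delta_planted linear_add[OF linear_Q0] linear_sum[OF linear_Q0]
      linear_scale[OF linear_Q0] Q0_X_normed linear_lin_ext_distrib[OF linear_Q0]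
    by (simp add: case_prod_unfold linear_scale[OF linear_Q0])
      (simp add: Q0_def noises1_planted)
  have W: "rel (bas (planted 0 s)) (bas (planted (0, 2) s))" for s
    by (simp add: rel_def W_planted)
  have 1: "rel (lin_ext (\<lambda>(s, b). g b *\<^sub>R (if noises1 s = 0 then bas (planted 0 s) else 0)) (Delta \<alpha> i t))
      (lin_ext (\<lambda>(s, b). g b *\<^sub>R (if noises1 s = 0 then bas (planted (0, 2) s) else 0)) (Delta \<alpha> i t))"
    by (intro rel_lin_ext) (auto intro!: rel_scaleR simp: W rel_0)
  have 2: "rel (\<Sum>p\<in>?S 0. ?c 0 p *\<^sub>R X_normed (fst p)) (\<Sum>p\<in>?up -` ?S 0. ?c (0, 2) p *\<^sub>R X_normed (fst p))"
  proof (rule rel_sum_shift)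
    let ?B = "{q. real (wt q) < deg \<alpha> i (planted 0 t)}"
    have "?S 0 \<subseteq> ?B \<times> ?B"
      by (auto simp: wt_add)
    then show "finite (?S 0)"
      by (rule finite_subset) (intro finite_cartesian_product finite_wt_less)
    show "inj ?up"
      by (auto simp: inj_def)
    show "rel (?c 0 p *\<^sub>R X_normed (fst p)) 0" if "p \<notin> range ?up" for p
    proof (intro rel_scaleR_0 rel_X_normed_0 shift_midx(2) notI)
      assume "fst p \<in> range (\<lambda>q. q + (0, 2))"
      then obtain q where "fst p = q + (0, 2)"
        by (rule imageE)
      then have "p = ?up (q, snd p)"
        by (simp add: prod_eq_iff)
      then have "p \<in> range ?up"
        by (rule range_eqI)
      with that show False
        by (rule notE)
    qed
    show "rel (?c 0 (?up p) *\<^sub>R X_normed (fst (?up p))) (?c (0, 2) p *\<^sub>R X_normed (fst p))" for p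
      using rel_scaleR[OF rel_X_normed, of "?c (0, 2) p" "fst p"] by (simp add: add_ac)
  qed
  have "?up -` ?S 0 = ?S (0, 2)"
    by (auto simp: deg_planted wt_add wt_def)
  with rel_add[OF 1 2] show ?thesis
    by (simp only: eq)
qed

lemma rel_Id_otimes_X_pow:
  defines "G \<equiv> \<lambda>g \<alpha> i p. (1 / mfact p) *\<^sub>R Q0 (Id_otimes g (Delta \<alpha> i (X_pow p)))"
  shows "snd p < 2 \<Longrightarrow> rel (G g \<alpha> i p) 0"
    and "rel (G g \<alpha> i (p + (0, 2))) (G g \<alpha> i p)"
proof -
  have eq: "G g \<alpha> i p = (\<Sum>q\<in>{..fst p} \<times> {..snd p}.
       (g (p - q, {#}) / mfact (p - q)) *\<^sub>R X_normed q)" for p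
    unfolding G_def linear_scale[OF linear_Q0, symmetric] Id_otimes_Delta_X_pow
    by (simp add: linear_sum[OF linear_Q0] linear_scale[OF linear_Q0] Q0_X_normed)
  have G: "rel (G g \<alpha> i p) (\<Sum>q\<in>(\<lambda>q. q + (0, 2)) -` ({..fst p} \<times> {..snd p}).
       (g (p - (q + (0, 2)), {#}) / mfact (p - (q + (0, 2)))) *\<^sub>R X_normed q)" for p
    unfolding eq
    by (rule rel_sum_shift)
      (auto intro: shift_midx rel_scaleR_0 rel_X_normed_0 rel_scaleR rel_X_normed)
  \<comment> \<open>With spatial exponent below 2 in p, no q \<le> p is a shifted index, and the
    derivative is an empty sum.\<close>
  have "(\<lambda>q. q + (0, 2)) -` ({..fst p} \<times> {..snd p}) = {}" if "snd p < 2"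
    using that by auto
  with G[of p] show "snd p < 2 \<Longrightarrow> rel (G g \<alpha> i p) 0"
    by simp
  have "(\<lambda>q. q + (0, 2)) -` ({..fst (p + (0, 2))} \<times> {..snd (p + (0, 2))}) = {..fst p} \<times> {..snd p}"
    by auto
  with G[of "p + (0, 2)"] show "rel (G g \<alpha> i (p + (0, 2))) (G g \<alpha> i p)"
    by (simp add: eq[of p])
qed

text \<open>The map u -> Q0 (\<Gamma> \<otimes> f) u behind \<open>d_Gamma\<close>, with \<Gamma> =
  (Id \<otimes> g) \<Delta> for \<open>Delta \<alpha> 0\<close> and arbitrary functions f and g in
  place of the characters.\<close>

definition dG :: "real \<Rightarrow> (pbasis \<Rightarrow> real) \<Rightarrow> (pbasis \<Rightarrow> real) \<Rightarrow> (dtree \<times> pbasis \<Rightarrow>\<^sub>0 real) \<Rightarrow> (dtree \<Rightarrow>\<^sub>0 real)"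
  where "dG \<alpha> g f u = Q0 (lin_ext (\<lambda>(s, b). f b *\<^sub>R Id_otimes g (Delta \<alpha> 0 s)) u)"

lemma linear_dG: "linear (dG \<alpha> g f)"
  unfolding dG_def[abs_def]
  using linear_compose[OF linear_lin_ext linear_Q0] by (simp add: comp_def)

lemma rel_dG_hat_Delta0_planted:
  "rel (dG \<alpha> g f (hat_Delta0 \<alpha> (planted 0 t))) (dG \<alpha> g f (hat_Delta0 \<alpha> (planted (0, 2) t)))"
proof -
  let ?H = "hat_Delta0 \<alpha> t"
  define N where "N = (\<lambda>a p. lin_ext (\<lambda>(s, c). Ip \<alpha> 0 (a + p) s * bas c) ?H)"
  define h where "h = (\<lambda>a p. if deg \<alpha> 1 (planted a t) \<le> real (wt p) then X_normed p \<otimes> N a p else 0)"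
  \<comment> \<open>A finite set outside which all symbols \<open>Ip \<alpha> 0 (a + p) s\<close>
    with s from \<open>hat_Delta0 \<alpha> t\<close> vanish. It turns \<open>Sum_any\<close> into a
    finite sum.\<close>
  define S where "S = (\<lambda>a. \<Union>s\<in>fst ` Poly_Mapping.keys ?H. {p. 0 < deg \<alpha> 0 (planted (a + p) s)})"
  define G where "G = (\<lambda>p. (1 / mfact p) *\<^sub>R Q0 (Id_otimes g (Delta \<alpha> 0 (X_pow p))))"
  define c where "c = (\<lambda>a p. if deg \<alpha> 1 (planted a t) \<le> real (wt p) then lin_ext f (N a p) else 0)"
  let ?up = "\<lambda>q :: midx. q + (0, 2)"
  have "{p. 0 < deg \<alpha> 0 (planted (a + p) s)} = {p. real (wt p) < deg \<alpha> 0 s + 2 - real (wt a)}" for a s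
    by (simp add: deg_planted wt_add algebra_simps)
  then have fin: "finite (S a)" for a
    by (simp add: S_def finite_wt_less)
  have N_0: "N a p = 0" if "p \<notin> S a" for a p
    using that unfolding N_def lin_ext_def S_def
    by (intro sum.neutral) (force simp: Ip_def)
  have Sum_any_eq: "Sum_any (h a) = (\<Sum>p\<in>S a. h a p)" for a
  proof (rule Sum_any.expand_superset[OF fin])
    have "h a p = 0" if "p \<notin> S a" for p
      by (simp add: h_def N_0[OF that] tensor_0_right)
    then show "{p. h a p \<noteq> 0} \<subseteq> S a"
      by blast
  qed
  have dG_h: "dG \<alpha> g f (h a p) = c a p *\<^sub>R G p" for a p
    by (auto simp: dG_def h_def c_def G_def lin_ext_tensor lin_ext_mult_right lin_ext_0 X_normed_def
        lin_ext_scaleR linear_scale[OF linear_Q0] linear_0[OF linear_Q0])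
  have eq: "dG \<alpha> g f (hat_Delta0 \<alpha> (planted a t)) =
      lin_ext (\<lambda>(s, b). f b *\<^sub>R Q0 (Id_otimes g (Delta \<alpha> 0 (planted a s)))) ?H
      - (\<Sum>p\<in>S a. c a p *\<^sub>R G p)" for a
  proof -
    have "hat_Delta0 \<alpha> (planted a t) = tensor_map (\<lambda>s. bas (planted a s)) bas ?H - (\<Sum>p\<in>S a. h a p)"
      using Sum_any_eq[of a] unfolding hat_Delta0_planted h_def N_def by (simp only:)
    then show ?thesis
      by (simp only: linear_diff[OF linear_dG] linear_sum[OF linear_dG] dG_h)
        (simp add: dG_def lin_ext_tensor_map tensor_bas case_prod_unfold
          linear_lin_ext_distrib[OF linear_Q0] linear_scale[OF linear_Q0])
  qed
  have 1: "rel (lin_ext (\<lambda>(s, b). f b *\<^sub>R Q0 (Id_otimes g (Delta \<alpha> 0 (planted 0 s)))) ?H)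
      (lin_ext (\<lambda>(s, b). f b *\<^sub>R Q0 (Id_otimes g (Delta \<alpha> 0 (planted (0, 2) s)))) ?H)"
    by (intro rel_lin_ext) (auto intro!: rel_scaleR rel_Id_otimes_planted)
  \<comment> \<open>\<open>N\<close> sees a and p only through a + p, and the cutoff by the degree
    with index 1 drops by 2 along with |p|.\<close>
  have c_up: "c 0 (?up p) = c (0, 2) p" for p
    by (auto simp: c_def N_def deg_planted wt_add add.commute) (simp_all add: wt_def)
  have 2: "rel (\<Sum>p\<in>S 0. c 0 p *\<^sub>R G p) (\<Sum>p\<in>?up -` S 0. c (0, 2) p *\<^sub>R G p)"
  proof (rule rel_sum_shift[OF fin shift_midx(1)])
    show "rel (c 0 p *\<^sub>R G p) 0" if "p \<notin> range ?up" for p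
      unfolding G_def by (intro rel_scaleR_0 rel_Id_otimes_X_pow(1) shift_midx(2) that)
    show "rel (c 0 (?up p) *\<^sub>R G (?up p)) (c (0, 2) p *\<^sub>R G p)" for p
      unfolding G_def c_up by (intro rel_scaleR rel_Id_otimes_X_pow(2))
  qed
  have "?up -` S 0 = S (0, 2)"
    by (auto simp: S_def add.commute)
  with rel_diff[OF 1 2] show ?thesis
    by (simp only: eq)
qed

end

theorem corollary4p7:
  fixes \<alpha> :: real
    and R :: "(dtree \<Rightarrow>\<^sub>0 real) \<Rightarrow> (dtree \<Rightarrow>\<^sub>0 real)"
    and K \<xi> \<delta>\<xi> :: "pt \<Rightarrow> real"
    and x y :: pt
    and \<tau> :: dtree
  assumes "truncated_heat_kernel K"
    and "smooth_fun_on UNIV \<xi>"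
    and "smooth_fun_on UNIV \<delta>\<xi>"
    and "preparation_map \<alpha> R"
    and "\<tau> \<in> T0"
  shows "F_hat \<alpha> R K \<xi> \<delta>\<xi> x y (bas (planted (0, 2) \<tau>)) y =
    pd 1 (pd 1 (\<lambda>z. delta_hat_Pi \<alpha> R K \<xi> \<delta>\<xi> x (bas (planted 0 \<tau>)) z
      - hat_Pi_lin \<alpha> R K \<xi> \<delta>\<xi> 1 y (d_Gamma \<alpha> R K \<xi> \<delta>\<xi> y x (bas (planted 0 \<tau>))) z)) y"
proof -
  interpret kernel K
    using assms(1) by (rule truncated_heat_kernel_imp_kernel)
  \<comment> \<open>The base point is y: \<open>d_Gamma\<close> maps to trees modelled at y, whereas
    x enters this term only through the coefficients.\<close>
  interpret dxx_model "hat_Pi \<alpha> R K \<xi> \<delta>\<xi> 1 y" y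
    by unfold_locales (simp_all only: has_dxx_hat_Pi_planted assms hat_Pi_X_pow)
  let ?\<delta>\<Pi> = "\<lambda>a. delta_hat_Pi \<alpha> R K \<xi> \<delta>\<xi> x (bas (planted a \<tau>))"
  let ?d\<Gamma> = "\<lambda>a. d_Gamma \<alpha> R K \<xi> \<delta>\<xi> y x (bas (planted a \<tau>))"
  let ?\<Pi> = "hat_Pi_lin \<alpha> R K \<xi> \<delta>\<xi> 1 y"
  \<comment> \<open>The rule for planted trees is needed for every \<epsilon>, with the perturbed
    noise in place of \<xi>.\<close>
  have "smooth (\<lambda>z. \<xi> z + \<epsilon> * \<delta>\<xi> z)" for \<epsilon>
    by (intro smooth_add smooth_cmult assms)
  then have "has_dxx (?\<delta>\<Pi> 0) (?\<delta>\<Pi> (0, 2))"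
    unfolding delta_hat_Pi_def[abs_def] malliavin_def hat_Pi_lin_def lin_ext_bas
    by (intro has_dxx_deriv_poly_family poly_family_hat_Pi has_dxx_hat_Pi_planted assms)
  \<comment> \<open>As \<open>D_Xi\<close> commutes with planting, linearity reduces the claim to
    \<open>hat_Delta0\<close> of single planted trees; the coefficients come from
    \<open>D_Xi \<tau>\<close> and are the same for both values of a.\<close>
  moreover have "?d\<Gamma> a = lin_ext (\<lambda>t. dG \<alpha> (gamma_char \<alpha> R K \<xi> \<delta>\<xi> 0 y x) (f_char \<alpha> R K \<xi> \<delta>\<xi> 0 x)
      (hat_Delta0 \<alpha> (planted a t))) (D_Xi \<tau>)" for a
    unfolding d_Gamma_def lin_ext_bas D_Xi_planted plant_def Gamma_def
      linear_lin_ext_distrib[OF linear_lin_ext] linear_lin_ext_distrib[OF linear_Q0] dG_def Id_otimes_def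
    ..
  then have "rel (?d\<Gamma> 0) (?d\<Gamma> (0, 2))"
    by (simp only: rel_lin_ext rel_dG_hat_Delta0_planted)
  then have "has_dxx (?\<Pi> (?d\<Gamma> 0)) (?\<Pi> (?d\<Gamma> (0, 2)))"
    unfolding rel_def hat_Pi_lin_def[abs_def] .
  ultimately have "has_dxx (\<lambda>z. ?\<delta>\<Pi> 0 z - ?\<Pi> (?d\<Gamma> 0) z) (\<lambda>z. ?\<delta>\<Pi> (0, 2) z - ?\<Pi> (?d\<Gamma> (0, 2)) z)"
    by (rule has_dxx_diff)
  then show ?thesis
    by (simp only: has_dxx_def F_hat_def)
qed

end
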